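(* Let $\mathcal{R}$ be right amenable. Each strongly irreducible subshift of $Q^M$ of finite type has the Moore property and the Myhill property.
   Context: Setting. A group $G$ acts transitively from the left on a non-empty set $M$; the action is written $(g,m)\mapsto g\triangleright m$. An element $m_0\in M$ and, for each $m\in M$, an element $g_{m_0,m}\in G$ with $g_{m_0,m}\triangleright m_0=m$ are fixed; $\mathcal{R}=((M,G,\triangleright),(m_0,(g_{m_0,m})_{m\in M}))$ is called a cell space. The stabiliser $G_0$ of $m_0$ is finite. The right semi-action of $G/G_0$ on $M$ is $m\triangleleft gG_0=g_{m_0,m}g\triangleright m_0$. Identify $M$ with $G/G_0$ via $m\mapsto\{g\in G: g\triangleright m_0=m\}$; then $m\triangleleft n=g_{m_0,m}\triangleright n$ for $m,n\in M$. For $A\subseteq M$, $A\triangleleft\mathfrak{g}=\{a\triangleleft\mathfrak{g}: a\in A\}$. $\mathcal{R}$ is finitely right generated, and $S$ is a fixed finite symmetric right generating set: a finite $S\subseteq G/G_0$ with $G_0\cdot S\subseteq S$ and $S^{-1}:=\{g^{-1}G_0: s\in S,\ g\in s\}\subseteq S$ such that each $m\in M$ has the form $(((m_0\triangleleft s_1)\triangleleft s_2)\cdots)\triangleleft s_k$ with $k\ge 0$, $s_i\in S$. $d$ is the path metric on $M$ of the graph with an edge from $m$ to $m\triangleleft s$ for $m\in M$, $s\in S$. $\mathbb{B}(m,\rho)=\{m'\in M: d(m,m')\le\rho\}$ and $\mathbb{B}(\rho)=\mathbb{B}(m_0,\rho)$ for $\rho\in\mathbb{N}_0$. For $A,B\subseteq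 M$, $d(A,B)=\inf\{d(a,b): a\in A, b\in B\}$ (with $\inf\emptyset=\infty$). $H$ is a fixed subgroup of $G$ containing all $g_{m_0,m}$, $m\in M$; $H_0=H\cap G_0$. $Q$ is a finite set. Patterns and subshifts. For $A\subseteq M$, an $A$-pattern is a map $p\colon A\to Q$, with domain $\mathrm{dom}(p)=A$; it is finite if $A$ is finite. For $g\in G$, $g\blacktriangleright p\colon g\triangleright A\to Q$, $m\mapsto p(g^{-1}\triangleright m)$. An $A$-pattern $p$ semi-occurs in an $A'$-pattern $p'$ if there is $h\in H$ with $h\triangleright A\subseteq A'$ and $h\blacktriangleright p=p'|_{h\triangleright A}$. For a set $\mathfrak{F}$ of finite patterns, $\langle\mathfrak{F}\rangle$ is the set of $c\in Q^M$ in which no $\mathfrak{f}\in\mathfrak{F}$ semi-occurs. A subset $X\subseteq Q^M$ is a subshift of $Q^M$ if $X=\langle\mathfrak{F}\rangle$ for some set $\mathfrak{F}$ of finite patterns; it is of finite type if $\mathfrak{F}$ can be chosen finite. A pattern is allowed in $X$ if it semi-occurs in some $x\in X$. For $X\subseteq Q^M$ and $A\subseteq M$, $X_A=\{x|_A: x\in X\}$. A subshift $X$ is $\kappa$-strongly irreducible ($\kappa\in\mathbb{N}_0$) if for all finite patterns $p,p'$ allowed in $X$ with $d(\mathrm{dom}(p),\mathrm{dom}(p'))\ge\kappa+1$ there is $x\in X$ with $x|_{\mathrm{dom}(p)}=p$ and $x|_{\mathrm{dom}(p')}=p'$; it is strongly irreducible if it is so for some $\kappa$. Local maps. For subshifts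 $X,Y$, a map $\Delta\colon X\to Y$ is $\kappa$-local if there are $N\subseteq\mathbb{B}(\kappa)$ with $G_0\triangleright N\subseteq N$ and $\delta\colon X_N\to Q$ with $\delta(h_0\blacktriangleright\ell)=\delta(\ell)$ for all $h_0\in H_0$, $\ell\in X_N$, such that $\Delta(x)(m)=\delta(n\mapsto x(m\triangleleft n))$ for all $x\in X$, $m\in M$; it is local if it is $\kappa$-local for some $\kappa\in\mathbb{N}_0$. $\Delta$ is pre-injective if for all $x,x'\in X$ such that $\{m: x(m)\ne x'(m)\}$ is finite and $\Delta(x)=\Delta(x')$, one has $x=x'$. A subshift $X$ has the Moore property if each surjective local map from $X$ to $X$ is pre-injective, and the Myhill property if each pre-injective local map from $X$ to $X$ is surjective. Amenability. $\mathcal{R}$ is right amenable if there is a finitely additive probability measure $\mu$ on all subsets of $M$ such that $\mu(A\triangleleft\mathfrak{g})=\mu(A)$ for all $\mathfrak{g}\in G/G_0$ and all $A\subseteq M$ on which $m\mapsto m\triangleleft\mathfrak{g}$ is injective. Since $G_0$ is finite, this is equivalent to the existence of a right Følner net, i.e. a net $(F_i)_{i\in I}$ of non-empty finite subsets of $M$ with $\lim_{i\in I}|\partial_\rho F_i|/|F_i|=0$ for every $\rho\in\mathbb{N}_0$, where $\partial_\rho F=\{m\in M:\mathbb{B}(m,\rho)\cap F\ne\emptyset\}\setminus\{m\in F:\mathbb{B}(m,\rho)\subseteq F\}$. *)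

theory Defs
  imports
    Complex_Main
    "HOL-Algebra.Group_Action"
    "HOL-Algebra.Left_Coset"
    "HOL-Library.Extended_Nat"
begin

section \<open>Cell spaces\<close>

text \<open>The left action \<open>g \<triangleright> m\<close> is written \<open>\<phi> g m\<close>, and the coordinate \<open>g\<^bsub>m0,m\<^esub>\<close> is written
  \<open>crd m\<close>.\<close>

locale cell_space = transitive_action G M \<phi>
  for G :: "('g, 'z) monoid_scheme" (structure)
    and M :: "'m set"
    and \<phi> :: "'g \<Rightarrow> 'm \<Rightarrow> 'm" +
  fixes m0 :: 'm
    and crd :: "'m \<Rightarrow> 'g"
  assumes origin: "m0 \<in> M"
    and crd_closed: "m \<in> M \<Longrightarrow> crd m \<in> carrier G"
    and crd_act: "m \<in> M \<Longrightarrow> \<phi> (crd m) m0 = m"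
begin

definition G0 :: "'g set" where
  "G0 = stabilizer G \<phi> m0"

text \<open>The right semi-action of \<open>G/G0\<close> on \<open>M\<close>; the choice of representative does not matter, see
  \<open>semi_act_coset\<close> below.\<close>

definition semi_act :: "'m \<Rightarrow> 'g set \<Rightarrow> 'm"  (infixl \<open>\<lhd>\<^sub>r\<close> 70) where
  "m \<lhd>\<^sub>r c = \<phi> (crd m \<otimes> (SOME g. g \<in> c)) m0"

text \<open>The identification of \<open>M\<close> with \<open>G/G0\<close>.\<close>

definition coset_of :: "'m \<Rightarrow> 'g set" where
  "coset_of m = {g \<in> carrier G. \<phi> g m0 = m}"

definition right_amenable :: bool where
  "right_amenable \<longleftrightarrow>
    (\<exists>\<mu> :: 'm set \<Rightarrow> real.
      (\<forall>A. A \<subseteq> M \<longrightarrow> 0 \<le> \<mu> A) \<and>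
      \<mu> M = 1 \<and>
      (\<forall>A B. A \<subseteq> M \<longrightarrow> B \<subseteq> M \<longrightarrow> A \<inter> B = {} \<longrightarrow> \<mu> (A \<union> B) = \<mu> A + \<mu> B) \<and>
      (\<forall>c \<in> lcosets G0. \<forall>A. A \<subseteq> M \<longrightarrow> inj_on (\<lambda>m. m \<lhd>\<^sub>r c) A \<longrightarrow>
        \<mu> ((\<lambda>m. m \<lhd>\<^sub>r c) ` A) = \<mu> A))"

lemma group_G: "group G"
  using group_hom group_hom.axioms(1) by blast

lemma G0_subgroup: "subgroup G0 G"
  unfolding G0_def by (rule stabilizer_subgroup[OF origin])

lemma semi_act_rep:
  assumes "m \<in> M" "c \<in> lcosets G0" "g \<in> c"
  shows "m \<lhd>\<^sub>r c = \<phi> (crd m \<otimes> g) m0"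
proof -
  interpret group G by (rule group_G)
  obtain a where a: "a \<in> carrier G" "c = a <# G0"
    using assms(2) unfolding LCOSETS_def by auto
  have *: "x \<in> carrier G \<and> \<phi> x m0 = \<phi> a m0" if x: "x \<in> c" for x
  proof -
    obtain h where h: "h \<in> G0" "x = a \<otimes> h"
      using x a(2) unfolding l_coset_def by auto
    then have "h \<in> carrier G" "\<phi> h m0 = m0"
      unfolding G0_def stabilizer_def by auto
    with h a(1) show ?thesis using origin composition_rule by simp
  qed
  have "(SOME g. g \<in> c) \<in> c" using assms(3) by (rule someI)
  with assms(1,3) show ?thesis
    unfolding semi_act_def using * origin crd_closed composition_rule by simp
qed

lemma semi_act_coset:
  assumes "m \<in> M" "g \<in> carrier G"
  shows "m \<lhd>\<^sub>r (g <# G0) = \<phi> (crd m \<otimes> g) m0"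
proof (rule semi_act_rep[OF assms(1)])
  show "g <# G0 \<in> lcosets G0" using assms(2) unfolding LCOSETS_def by blast
  show "g \<in> g <# G0"
    using group.lcos_self[OF group_G assms(2) G0_subgroup] .
qed

lemma coset_of_eq:
  assumes "m \<in> M"
  shows "coset_of m = crd m <# G0"
proof -
  interpret group G by (rule group_G)
  have c: "crd m \<in> carrier G" "\<phi> (crd m) m0 = m" using assms crd_closed crd_act by auto
  show ?thesis
  proof (intro equalityI subsetI)
    fix g assume "g \<in> coset_of m"
    then have g: "g \<in> carrier G" "\<phi> g m0 = m" unfolding coset_of_def by auto
    have "\<phi> (inv (crd m) \<otimes> g) m0 = \<phi> (inv (crd m)) m"
      using g c origin composition_rule by simp
    also have "\<dots> = m0" using orbit_sym_aux[OF c(1) origin c(2)] .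
    finally have "inv (crd m) \<otimes> g \<in> G0"
      unfolding G0_def stabilizer_def using g c by simp
    moreover have "g = crd m \<otimes> (inv (crd m) \<otimes> g)"
      using g c by (simp add: m_assoc[symmetric])
    ultimately show "g \<in> crd m <# G0" unfolding l_coset_def by blast
  next
    fix g assume "g \<in> crd m <# G0"
    then show "g \<in> coset_of m"
      using c origin composition_rule
      unfolding l_coset_def coset_of_def G0_def stabilizer_def by auto
  qed
qed

lemma semi_act_coset_of:
  assumes "m \<in> M" "n \<in> M"
  shows "m \<lhd>\<^sub>r coset_of n = \<phi> (crd m) n"
  using assms crd_closed crd_act origin composition_rule
  by (simp add: coset_of_eq semi_act_coset)

end


section \<open>Patterns, subshifts and local maps\<close>

text \<open>\<open>S\<close> is a finite symmetric right generating set.\<close>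

locale pattern_space = cell_space G M \<phi> m0 crd
  for G :: "('g, 'z) monoid_scheme" (structure)
    and M :: "'m set" and \<phi> and m0 and crd +
  fixes S :: "'g set set"
    and H :: "'g set"
    and Q :: "'q set"
  assumes finite_G0: "finite G0"
    and S_subset: "S \<subseteq> lcosets G0"
    and finite_S: "finite S"
    and G0_S: "\<lbrakk>g \<in> G0; s \<in> S\<rbrakk> \<Longrightarrow> g <# s \<in> S"
    and S_inverse: "\<lbrakk>s \<in> S; g \<in> s\<rbrakk> \<Longrightarrow> inv g <# G0 \<in> S"
    and generates: "m \<in> M \<Longrightarrow> \<exists>ss. set ss \<subseteq> S \<and> foldl (\<lhd>\<^sub>r) m0 ss = m"
    and H_subgroup: "subgroup H G"
    and crd_H: "m \<in> M \<Longrightarrow> crd m \<in> H"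
    and finite_Q: "finite Q"
begin

definition H0 :: "'g set" where
  "H0 = H \<inter> G0"

definition edges :: "('m \<times> 'm) set" where
  "edges = {(m, m \<lhd>\<^sub>r s) | m s. m \<in> M \<and> s \<in> S}"

text \<open>The edge relation is symmetric and any two cells are connected (see \<open>edges_sym\<close> and
  \<open>edges_connected\<close> below), so on \<open>M\<close> this is the path metric of an undirected connected graph.\<close>

definition path_dist :: "'m \<Rightarrow> 'm \<Rightarrow> nat" where
  "path_dist m m' = (LEAST k. (m, m') \<in> edges ^^ k)"

definition cell_ball :: "'m \<Rightarrow> nat \<Rightarrow> 'm set" where
  "cell_ball m \<rho> = {m' \<in> M. path_dist m m' \<le> \<rho>}"

definition set_dist :: "'m set \<Rightarrow> 'm set \<Rightarrow> enat" where
  "set_dist A B = Inf {enat (path_dist a b) | a b. a \<in> A \<and> b \<in> B}"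

text \<open>An \<open>A\<close>-pattern is a partial map with domain exactly \<open>A\<close>.\<close>

definition patterns :: "'m set \<Rightarrow> ('m \<rightharpoonup> 'q) set" where
  "patterns A = {p. dom p = A \<and> ran p \<subseteq> Q}"

definition finite_patterns :: "('m \<rightharpoonup> 'q) set" where
  "finite_patterns = (\<Union>A \<in> {A. A \<subseteq> M \<and> finite A}. patterns A)"

text \<open>The guard is needed since \<open>\<phi> g\<close> is unspecified outside of \<open>M\<close>.\<close>

definition pat_act :: "'g \<Rightarrow> ('m \<rightharpoonup> 'q) \<Rightarrow> ('m \<rightharpoonup> 'q)" where
  "pat_act g p = (\<lambda>m. if m \<in> M then p (\<phi> (inv g) m) else None)"

definition semi_occurs :: "('m \<rightharpoonup> 'q) \<Rightarrow> ('m \<rightharpoonup> 'q) \<Rightarrow> bool" where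
  "semi_occurs p p' \<longleftrightarrow>
    (\<exists>h \<in> H. \<phi> h ` dom p \<subseteq> dom p' \<and> pat_act h p = p' |` (\<phi> h ` dom p))"

definition avoiding :: "('m \<rightharpoonup> 'q) set \<Rightarrow> ('m \<rightharpoonup> 'q) set" where
  "avoiding F = {c \<in> patterns M. \<forall>f \<in> F. \<not> semi_occurs f c}"

definition subshift :: "('m \<rightharpoonup> 'q) set \<Rightarrow> bool" where
  "subshift X \<longleftrightarrow> (\<exists>F. F \<subseteq> finite_patterns \<and> X = avoiding F)"

definition finite_type :: "('m \<rightharpoonup> 'q) set \<Rightarrow> bool" where
  "finite_type X \<longleftrightarrow> (\<exists>F. F \<subseteq> finite_patterns \<and> finite F \<and> X = avoiding F)"

definition allowed :: "('m \<rightharpoonup> 'q) set \<Rightarrow> ('m \<rightharpoonup> 'q) \<Rightarrow> bool" where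
  "allowed X p \<longleftrightarrow> (\<exists>x \<in> X. semi_occurs p x)"

definition restrictions :: "('m \<rightharpoonup> 'q) set \<Rightarrow> 'm set \<Rightarrow> ('m \<rightharpoonup> 'q) set" where
  "restrictions X A = {x |` A | x. x \<in> X}"

definition strongly_irreducible_with :: "nat \<Rightarrow> ('m \<rightharpoonup> 'q) set \<Rightarrow> bool" where
  "strongly_irreducible_with \<kappa> X \<longleftrightarrow>
    (\<forall>p \<in> finite_patterns. \<forall>p' \<in> finite_patterns.
      allowed X p \<longrightarrow> allowed X p' \<longrightarrow> set_dist (dom p) (dom p') \<ge> enat (\<kappa> + 1) \<longrightarrow>
      (\<exists>x \<in> X. x |` dom p = p \<and> x |` dom p' = p'))"

definition strongly_irreducible :: "('m \<rightharpoonup> 'q) set \<Rightarrow> bool" where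
  "strongly_irreducible X \<longleftrightarrow> (\<exists>\<kappa>. strongly_irreducible_with \<kappa> X)"

definition local_with ::
    "nat \<Rightarrow> ('m \<rightharpoonup> 'q) set \<Rightarrow> ('m \<rightharpoonup> 'q) set \<Rightarrow> (('m \<rightharpoonup> 'q) \<Rightarrow> ('m \<rightharpoonup> 'q)) \<Rightarrow> bool" where
  "local_with \<kappa> X Y \<Delta> \<longleftrightarrow>
    \<Delta> \<in> X \<rightarrow> Y \<and>
    (\<exists>N \<delta>.
      N \<subseteq> cell_ball m0 \<kappa> \<and>
      (\<forall>g \<in> G0. \<phi> g ` N \<subseteq> N) \<and>
      \<delta> \<in> restrictions X N \<rightarrow> Q \<and>
      (\<forall>h \<in> H0. \<forall>l \<in> restrictions X N. \<delta> (pat_act h l) = \<delta> l) \<and>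
      (\<forall>x \<in> X. \<forall>m \<in> M.
        \<Delta> x m = Some (\<delta> (\<lambda>n. if n \<in> N then x (m \<lhd>\<^sub>r coset_of n) else None))))"

definition local_map ::
    "('m \<rightharpoonup> 'q) set \<Rightarrow> ('m \<rightharpoonup> 'q) set \<Rightarrow> (('m \<rightharpoonup> 'q) \<Rightarrow> ('m \<rightharpoonup> 'q)) \<Rightarrow> bool" where
  "local_map X Y \<Delta> \<longleftrightarrow> (\<exists>\<kappa>. local_with \<kappa> X Y \<Delta>)"

definition pre_injective ::
    "('m \<rightharpoonup> 'q) set \<Rightarrow> (('m \<rightharpoonup> 'q) \<Rightarrow> ('m \<rightharpoonup> 'q)) \<Rightarrow> bool" where
  "pre_injective X \<Delta> \<longleftrightarrow>
    (\<forall>x \<in> X. \<forall>x' \<in> X. finite {m \<in> M. x m \<noteq> x' m} \<longrightarrow> \<Delta> x = \<Delta> x' \<longrightarrow> x = x')"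

definition Moore_property :: "('m \<rightharpoonup> 'q) set \<Rightarrow> bool" where
  "Moore_property X \<longleftrightarrow> (\<forall>\<Delta>. local_map X X \<Delta> \<longrightarrow> \<Delta> ` X = X \<longrightarrow> pre_injective X \<Delta>)"

definition Myhill_property :: "('m \<rightharpoonup> 'q) set \<Rightarrow> bool" where
  "Myhill_property X \<longleftrightarrow> (\<forall>\<Delta>. local_map X X \<Delta> \<longrightarrow> pre_injective X \<Delta> \<longrightarrow> \<Delta> ` X = X)"

lemma semi_act_closed:
  assumes "m \<in> M" "s \<in> S"
  shows "m \<lhd>\<^sub>r s \<in> M"
proof -
  interpret group G by (rule group_G)
  obtain a where a: "a \<in> carrier G" "s = a <# G0"
    using assms(2) S_subset unfolding LCOSETS_def by blast
  show ?thesis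
    unfolding a(2) semi_act_coset[OF assms(1) a(1)]
    by (rule element_image[OF _ origin refl]) (simp add: a(1) crd_closed assms(1))
qed

lemma edges_sym: "sym edges"
proof (rule symI)
  interpret group G by (rule group_G)
  fix m m' assume "(m, m') \<in> edges"
  then obtain s where s: "m \<in> M" "s \<in> S" "m' = m \<lhd>\<^sub>r s" unfolding edges_def by blast
  obtain a where a: "a \<in> carrier G" "s = a <# G0"
    using s(2) S_subset unfolding LCOSETS_def by blast
  have m': "m' \<in> M" using s semi_act_closed by simp
  have ca: "crd m \<in> carrier G" "crd m' \<in> carrier G" using s m' crd_closed by auto
  define g where "g = inv (crd m) \<otimes> crd m'"
  have "crd m' \<in> coset_of m'" unfolding coset_of_def using m' crd_closed crd_act by simp
  moreover have "m' = \<phi> (crd m \<otimes> a) m0" using s a semi_act_coset by simp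
  ultimately have "\<phi> (crd m') m0 = \<phi> (crd m \<otimes> a) m0" using m' crd_act by simp
  then have "\<phi> g m0 = \<phi> (inv (crd m)) (\<phi> (crd m) (\<phi> a m0))"
    unfolding g_def using ca a(1) origin composition_rule by simp
  also have "\<dots> = \<phi> a m0"
    using orbit_sym_aux[OF ca(1) element_image[OF a(1) origin refl] refl] .
  finally have ga: "\<phi> g m0 = \<phi> a m0" .
  have g: "g \<in> carrier G" unfolding g_def using ca by simp
  have "\<phi> (inv a \<otimes> g) m0 = m0"
    using ga g a(1) origin composition_rule orbit_sym_aux[OF a(1) origin refl] by simp
  then have "inv a \<otimes> g \<in> G0" unfolding G0_def stabilizer_def using a(1) g by simp
  moreover have "g = a \<otimes> (inv a \<otimes> g)" using a(1) g by (simp add: m_assoc[symmetric])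
  ultimately have "g \<in> s" unfolding a(2) l_coset_def by blast
  then have t: "inv g <# G0 \<in> S" using S_inverse s(2) by blast
  have "crd m' \<otimes> inv g = crd m"
    unfolding g_def using ca by (simp add: inv_mult_group m_assoc[symmetric])
  then have "m' \<lhd>\<^sub>r (inv g <# G0) = m"
    using semi_act_coset[OF m', of "inv g"] g s(1) crd_act by simp
  then show "(m', m) \<in> edges" unfolding edges_def using m' t by force
qed

lemma edges_connected:
  assumes "m \<in> M" "m' \<in> M"
  shows "\<exists>k. (m, m') \<in> edges ^^ k"
proof -
  have path: "set ss \<subseteq> S \<Longrightarrow> x \<in> M \<Longrightarrow> (x, foldl (\<lhd>\<^sub>r) x ss) \<in> edges\<^sup>*" for ss x
  proof (induction ss arbitrary: x)
    case (Cons s ss)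
    then have "(x, x \<lhd>\<^sub>r s) \<in> edges" unfolding edges_def by auto
    moreover have "(x \<lhd>\<^sub>r s, foldl (\<lhd>\<^sub>r) (x \<lhd>\<^sub>r s) ss) \<in> edges\<^sup>*"
      using Cons semi_act_closed by simp
    ultimately show ?case by (simp add: converse_rtrancl_into_rtrancl)
  qed simp
  have "(m0, m) \<in> edges\<^sup>*" "(m0, m') \<in> edges\<^sup>*"
    using path[OF _ origin] generates assms by metis+
  moreover have "sym (edges\<^sup>*)" using edges_sym by (rule sym_rtrancl)
  ultimately have "(m, m') \<in> edges\<^sup>*" by (meson rtrancl_trans symD)
  then show ?thesis using rtrancl_power by blast
qed

end

end

theory Submission
  imports Defs "HOL-Analysis.Function_Topology"
begin

text \<open>
  If there were no Foelner sets, then some neighbourhood operation would at least double every finite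
  set, Hall's theorem would give two injections of \<open>M\<close> into itself of bounded displacement with
  disjoint images, and both images would have mean one.

  For the Garden of Eden theorem, patterns on a Foelner set \<open>F\<close> are counted. Prohibiting one fixed
  pattern at well separated centres of positive density in \<open>F\<close> makes the number of patterns drop by a
  factor exponential in \<open>card F\<close>, by strong irreducibility, while passing to a collar of \<open>F\<close> gains
  only a factor exponential in \<open>card (\<partial>F)\<close>. If \<open>\<Delta>\<close> is not surjective, then by compactness its image
  misses a pattern, so it has too few patterns to keep apart the configurations that equal a given one
  away from \<open>F\<close>, and \<open>\<Delta>\<close> is not pre-injective. If \<open>\<Delta>\<close> is not pre-injective, then one of two
  patterns with equal images can be dispensed with, so the image has fewer patterns than the full
  subshift.
\<close>


section \<open>Compactness and Hall's theorem\<close>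

text \<open>No entropy and no limit along a net is used: all constants are fixed first, and a single
  Foelner set \<open>F\<close> then yields a strict inequality between two finite cardinalities.
  Patterns are counted on \<open>nbhd F R\<close> instead of \<open>F\<close>, so that every ball of
  radius \<open>R\<close> centred in \<open>F\<close> lies inside the counted region and only outer
  boundaries have to be small. Strong irreducibility joins finite patterns only, whereas
  pre-injectivity compares configurations on all of \<open>M\<close>. Finite type bridges this gap:
  it lets a configuration be replaced on a finite region while its values elsewhere are kept. The
  coordinates \<open>crd m\<close> are arbitrary, so the semi-action commutes with the left action
  only up to elements of \<open>G0\<close>. The invariance of \<open>S\<close> and of the local
  rules under this error makes the metric \<open>G\<close>-invariant and local maps
  \<open>H\<close>-equivariant, and equivariance is what moves one pattern to all centres.\<close>

text \<open>Tychonoff for the product of the finite discrete spaces \<open>K i\<close>: by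
  \<open>cong\<close> the solutions for a finite \<open>A\<close> form a closed set, and by
  \<open>mono\<close> and \<open>ex\<close> these sets have the finite intersection property.
  \<open>P\<close> is kept abstract so that the result serves matchings as well as preimages under
  local maps.\<close>

lemma finitary_choice_compactness:
  fixes K :: "'a \<Rightarrow> 'b set"
  assumes finite_K: "\<And>i. i \<in> I \<Longrightarrow> finite (K i)"
    and mono: "\<And>A B f. finite B \<Longrightarrow> B \<subseteq> I \<Longrightarrow> A \<subseteq> B \<Longrightarrow> P B f \<Longrightarrow> P A f"
    and cong: "\<And>A f g. finite A \<Longrightarrow> A \<subseteq> I \<Longrightarrow> (\<And>i. i \<in> A \<Longrightarrow> f i = g i) \<Longrightarrow> P A f \<Longrightarrow> P A g"
    and ex: "\<And>A. finite A \<Longrightarrow> A \<subseteq> I \<Longrightarrow> \<exists>f. (\<forall>i\<in>A. f i \<in> K i) \<and> P A f"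
  shows "\<exists>f. (\<forall>i\<in>I. f i \<in> K i) \<and> (\<forall>A. finite A \<longrightarrow> A \<subseteq> I \<longrightarrow> P A f)"
proof -
  define T where "T = product_topology (\<lambda>i. discrete_topology (K i)) I"
  define C where "C A = {f \<in> PiE I K. P A f}" for A
  have top: "topspace T = PiE I K" unfolding T_def by simp
  have compact: "compact_space T"
    unfolding T_def compact_space_product_topology
    using finite_K by (simp add: compact_space_discrete_topology)
  have closed: "closedin T (C A)" if A: "finite A" "A \<subseteq> I" for A
  proof -
    have "openin T (topspace T - C A)"
    proof (subst openin_subopen, intro ballI)
      fix f assume f: "f \<in> topspace T - C A"
      \<comment> \<open>Fixing the finitely many coordinates in \<open>A\<close> gives a basic open
        set, and by \<open>cong\<close> the failure of \<open>P A\<close> at \<open>f\<close>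
        spreads to all of it.\<close>
      define U where "U = PiE I (\<lambda>i. if i \<in> A then {f i} else K i)"
      have fK: "f \<in> PiE I K" using f top by simp
      have "{i \<in> I. (if i \<in> A then {f i} else K i) \<noteq> K i} \<subseteq> A" by auto
      then have "finite {i \<in> I. (if i \<in> A then {f i} else K i) \<noteq> K i}"
        using A(1) by (rule finite_subset)
      moreover have "\<forall>i\<in>I. (if i \<in> A then {f i} else K i) \<subseteq> K i" using fK by auto
      ultimately have "openin T U"
        unfolding T_def U_def openin_PiE_gen by simp
      moreover have "f \<in> U" unfolding U_def using fK by (auto simp: PiE_iff)
      moreover have "U \<subseteq> topspace T - C A"
      proof
        fix g assume g: "g \<in> U"
        then have gK: "g \<in> PiE I K" unfolding U_def using fK
          by (auto simp: PiE_iff split: if_splits)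
        moreover have "g i = f i" if "i \<in> A" for i
          using g that A unfolding U_def by (force simp: PiE_iff)
        then have "\<not> P A g" using f top cong[OF A, of g f] unfolding C_def by auto
        ultimately show "g \<in> topspace T - C A" unfolding top C_def by simp
      qed
      ultimately show "\<exists>U. openin T U \<and> f \<in> U \<and> U \<subseteq> topspace T - C A" by blast
    qed
    then show ?thesis unfolding closedin_def top C_def by auto
  qed
  \<comment> \<open>Needed to extend a solution on a finite \<open>A\<close> to a point of the full
    product.\<close>
  have Kne: "K i \<noteq> {}" if "i \<in> I" for i
    using ex[of "{i}"] that by auto
  have ne: "C A \<noteq> {}" if A: "finite A" "A \<subseteq> I" for A
  proof -
    obtain f where f: "\<forall>i\<in>A. f i \<in> K i" "P A f" using ex[OF A] by blast
    define g where "g = restrict (\<lambda>i. if i \<in> A then f i else SOME k. k \<in> K i) I"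
    have "g \<in> PiE I K" unfolding g_def using f(1) Kne some_in_eq by (auto simp: PiE_iff)
    moreover have "P A g" by (rule cong[OF A _ f(2)]) (use A in \<open>auto simp: g_def\<close>)
    ultimately show ?thesis unfolding C_def by blast
  qed
  define \<U> where "\<U> = C ` {A. finite A \<and> A \<subseteq> I}"
  have "\<Inter>\<F> \<noteq> {}" if F: "finite \<F>" "\<F> \<subseteq> \<U>" for \<F>
  proof -
    obtain \<A> where A: "finite \<A>" "\<A> \<subseteq> {A. finite A \<and> A \<subseteq> I}" "\<F> = C ` \<A>"
      using finite_subset_image[OF F(1), of C "{A. finite A \<and> A \<subseteq> I}"] F(2) unfolding \<U>_def by blast
    have fin: "finite (\<Union>\<A>)" "\<Union>\<A> \<subseteq> I" using A by auto
    have "C (\<Union>\<A>) \<subseteq> \<Inter>\<F>"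
      using mono[OF fin] unfolding A(3) C_def by (auto intro: Sup_upper)
    then show ?thesis using ne[OF fin] by auto
  qed
  moreover have "\<forall>U\<in>\<U>. closedin T U" unfolding \<U>_def using closed by auto
  ultimately have "\<Inter>\<U> \<noteq> {}" using compact[unfolded compact_space_fip] by simp
  then obtain f where f: "f \<in> \<Inter>\<U>" by blast
  then have "f \<in> C {}" "\<And>A. finite A \<Longrightarrow> A \<subseteq> I \<Longrightarrow> P A f"
    unfolding \<U>_def C_def by auto
  then show ?thesis unfolding C_def by auto
qed

text \<open>The Halmos-Vaughan induction. If a proper nonempty \<open>J\<close> is tight, match
  \<open>J\<close> first; \<open>K \<union> J\<close> has at least \<open>card K + card J\<close>
  neighbours, so \<open>K\<close> keeps enough of them outside those of \<open>J\<close>. If no such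
  \<open>J\<close> exists, every proper nonempty subset has a spare neighbour, which pays for
  removing the partner \<open>x\<close> of one element.\<close>

lemma finite_Hall:
  fixes N :: "'a \<Rightarrow> 'b set"
  assumes "finite I" "\<And>i. i \<in> I \<Longrightarrow> finite (N i)"
    and "\<And>J. J \<subseteq> I \<Longrightarrow> card J \<le> card (\<Union>(N ` J))"
  shows "\<exists>f. inj_on f I \<and> (\<forall>i\<in>I. f i \<in> N i)"
  using assms
proof (induction I arbitrary: N rule: finite_psubset_induct)
  case (psubset I)
  have finU: "finite (\<Union>(N ` J))" if "J \<subseteq> I" for J
    using that psubset.hyps psubset.prems(1) by (meson finite_UN finite_subset subsetD)
  consider "I = {}" | (tight) J where "J \<noteq> {}" "J \<subset> I" "card (\<Union>(N ` J)) \<le> card J"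
    | (slack) "I \<noteq> {}" "\<And>J. J \<noteq> {} \<Longrightarrow> J \<subset> I \<Longrightarrow> card J < card (\<Union>(N ` J))"
    by (meson not_le)
  then show ?case
  proof cases
    case 1 then show ?thesis by simp
  next
    case tight
    have finJ: "finite J" using tight psubset.hyps finite_subset by blast
    have "\<exists>f. inj_on f J \<and> (\<forall>i\<in>J. f i \<in> N i)"
      by (rule psubset.IH) (use tight psubset.prems in auto)
    then obtain f where f: "inj_on f J" "\<And>i. i \<in> J \<Longrightarrow> f i \<in> N i" by blast
    define N' where "N' i = N i - \<Union>(N ` J)" for i
    have "\<exists>g. inj_on g (I - J) \<and> (\<forall>i\<in>I-J. g i \<in> N' i)"
    proof (rule psubset.IH)
      show "I - J \<subset> I" using tight by auto
      show "finite (N' i)" if "i \<in> I - J" for i using that psubset.prems(1) by (simp add: N'_def)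
      show "card K \<le> card (\<Union>(N' ` K))" if K: "K \<subseteq> I - J" for K
      proof -
        have "card K + card J = card (K \<union> J)"
          using K finJ psubset.hyps by (intro card_Un_disjoint[symmetric]) (auto intro: finite_subset)
        also have "\<dots> \<le> card (\<Union>(N ` (K \<union> J)))"
          using K tight by (intro psubset.prems(2)) auto
        also have "\<Union>(N ` (K \<union> J)) = \<Union>(N' ` K) \<union> \<Union>(N ` J)" unfolding N'_def by auto
        also have "card \<dots> \<le> card (\<Union>(N' ` K)) + card (\<Union>(N ` J))" by (rule card_Un_le)
        finally show ?thesis using tight(3) by linarith
      qed
    qed
    then obtain g where g: "inj_on g (I - J)" "\<And>i. i \<in> I - J \<Longrightarrow> g i \<in> N' i" by blast
    define h where "h i = (if i \<in> J then f i else g i)" for i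
    have "f i \<noteq> g j" if "i \<in> J" "j \<in> I - J" for i j
      using f(2)[OF that(1)] g(2)[OF that(2)] that(1) unfolding N'_def by auto
    moreover have "inj_on h J" "inj_on h (I - J)"
      using f(1) g(1) unfolding inj_on_def h_def by auto
    moreover have "h ` J \<inter> h ` (I - J) = {}" using calculation(1) unfolding h_def by force
    ultimately have "inj_on h (J \<union> (I - J))" unfolding inj_on_Un by blast
    then have "inj_on h I" using tight(2) by (simp add: Un_absorb1 psubset_imp_subset)
    moreover have "\<forall>i\<in>I. h i \<in> N i" unfolding h_def using f(2) g(2) by (auto simp: N'_def)
    ultimately show ?thesis by blast
  next
    case slack
    obtain i where i: "i \<in> I" using slack(1) by blast
    have "card {i} \<le> card (N i)" using psubset.prems(2)[of "{i}"] i by simp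
    then obtain x where x: "x \<in> N i" by fastforce
    define N' where "N' j = N j - {x}" for j
    have "\<exists>g. inj_on g (I - {i}) \<and> (\<forall>j\<in>I-{i}. g j \<in> N' j)"
    proof (rule psubset.IH)
      show "I - {i} \<subset> I" using i by auto
      show "finite (N' j)" if "j \<in> I - {i}" for j using that psubset.prems(1) by (simp add: N'_def)
      show "card K \<le> card (\<Union>(N' ` K))" if K: "K \<subseteq> I - {i}" for K
      proof (cases "K = {}")
        case False
        then have "card K < card (\<Union>(N ` K))" using slack(2) K i by auto
        also have "\<Union>(N ` K) \<subseteq> \<Union>(N' ` K) \<union> {x}" unfolding N'_def by auto
        then have "card (\<Union>(N ` K)) \<le> card (\<Union>(N' ` K) \<union> {x})"
          by (intro card_mono) (use finU[of K] K in \<open>auto simp: N'_def intro: finite_subset\<close>)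
        also have "\<dots> \<le> card (\<Union>(N' ` K)) + 1" using card_Un_le[of _ "{x}"] by simp
        finally show ?thesis by linarith
      qed simp
    qed
    then obtain g where g: "inj_on g (I - {i})" "\<And>j. j \<in> I - {i} \<Longrightarrow> g j \<in> N' j" by blast
    have "x \<notin> g ` (I - {i})" using g(2) unfolding N'_def by blast
    then have "inj_on (g(i := x)) (insert i (I - {i}))"
      using g(1) by (auto simp: inj_on_def)
    then have "inj_on (g(i := x)) I" using i by (simp add: insert_absorb)

    moreover have "\<forall>j\<in>I. (g(i := x)) j \<in> N j" using g(2) x by (auto simp: N'_def)
    ultimately show ?thesis by blast
  qed
qed

text \<open>Compactness applies because injectivity on a finite set depends only on the values
  there, and injectivity on \<open>I\<close> is tested on sets of at most two elements.\<close>

lemma locally_finite_Hall: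
  fixes N :: "'a \<Rightarrow> 'b set"
  assumes finite_N: "\<And>i. i \<in> I \<Longrightarrow> finite (N i)"
    and Hall: "\<And>J. finite J \<Longrightarrow> J \<subseteq> I \<Longrightarrow> card J \<le> card (\<Union>(N ` J))"
  shows "\<exists>f. inj_on f I \<and> (\<forall>i\<in>I. f i \<in> N i)"
proof -
  have "\<exists>f. (\<forall>i\<in>I. f i \<in> N i) \<and> (\<forall>A. finite A \<longrightarrow> A \<subseteq> I \<longrightarrow> inj_on f A)"
  proof (rule finitary_choice_compactness[where K = N and P = "\<lambda>A f. inj_on f A"])
    show "\<exists>f. (\<forall>i\<in>A. f i \<in> N i) \<and> inj_on f A" if "finite A" "A \<subseteq> I" for A
    proof -
      have "\<exists>f. inj_on f A \<and> (\<forall>i\<in>A. f i \<in> N i)"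
      proof (rule finite_Hall[OF that(1)])
        show "card J \<le> card (\<Union>(N ` J))" if "J \<subseteq> A" for J
          by (rule Hall) (use that \<open>finite A\<close> \<open>A \<subseteq> I\<close> finite_subset in auto)
      qed (use finite_N that in auto)
      then show ?thesis by blast
    qed
    show "inj_on g A" if "\<And>i. i \<in> A \<Longrightarrow> f i = g i" "inj_on f A" for A and f g :: "'a \<Rightarrow> 'b"
      using that inj_on_cong[of A f g] by auto
  qed (use finite_N in \<open>auto intro: inj_on_subset\<close>)
  then obtain f where f: "\<forall>i\<in>I. f i \<in> N i" "\<forall>A. finite A \<longrightarrow> A \<subseteq> I \<longrightarrow> inj_on f A" by (elim exE conjE)
  have "inj_on f I"
  proof (rule inj_onI)
    fix i j assume ij: "i \<in> I" "j \<in> I" "f i = f j"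
    have "inj_on f {i, j}" by (rule f(2)[rule_format]) (use ij in auto)
    then show "i = j" using ij(3) by (rule inj_onD) simp_all
  qed
  with f(1) show ?thesis by blast
qed

text \<open>On \<open>Z\<close> the map \<open>q\<close> factors through \<open>p\<close>. In the
  counting arguments \<open>p\<close> and \<open>q\<close> are views of a configuration, or of its
  image, through two finite windows.\<close>

lemma card_image_le_of_determined:
  assumes "finite (p ` Z)" and "\<And>x y. x \<in> Z \<Longrightarrow> y \<in> Z \<Longrightarrow> p x = p y \<Longrightarrow> q x = q y"
  shows "card (q ` Z) \<le> card (p ` Z)"
proof -
  define s where "s u = (SOME x. x \<in> Z \<and> p x = u)" for u
  have s: "s (p x) \<in> Z \<and> p (s (p x)) = p x" if "x \<in> Z" for x
    unfolding s_def by (rule someI[of _ x]) (simp add: that)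
  have "q ` Z \<subseteq> (\<lambda>u. q (s u)) ` p ` Z"
  proof
    fix v assume "v \<in> q ` Z"
    then obtain x where x: "x \<in> Z" "v = q x" by blast
    then have "q (s (p x)) = q x" using s[OF x(1)] by (intro assms(2)) auto
    then show "v \<in> (\<lambda>u. q (s u)) ` p ` Z" using x by (auto intro!: image_eqI)
  qed
  then have "card (q ` Z) \<le> card ((\<lambda>u. q (s u)) ` p ` Z)"
    using assms(1) by (intro card_mono) auto
  also have "\<dots> \<le> card (p ` Z)" using assms(1) by (rule card_image_le)
  finally show ?thesis .
qed


section \<open>The path metric\<close>

context cell_space
begin

lemma act_closed [simp]: "g \<in> carrier G \<Longrightarrow> m \<in> M \<Longrightarrow> \<phi> g m \<in> M"
  using element_image by blast

lemma act_inv [simp]: "g \<in> carrier G \<Longrightarrow> m \<in> M \<Longrightarrow> \<phi> (inv g) (\<phi> g m) = m"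
  using orbit_sym_aux by blast

lemma act_act_inv [simp]: "g \<in> carrier G \<Longrightarrow> m \<in> M \<Longrightarrow> \<phi> g (\<phi> (inv g) m) = m"
  using act_inv[of "inv g" m] group.inv_inv[OF group_G] group.inv_closed[OF group_G] by simp

text \<open>Both \<open>g \<otimes> crd m\<close> and \<open>crd (\<phi> g m)\<close> carry
  \<open>m0\<close> to \<open>\<phi> g m\<close>. Their quotient measures how far the chosen
  coordinates are from being compatible with the action.\<close>

lemma stabilizer_of_crd:
  assumes "g \<in> carrier G" "m \<in> M"
  shows "inv (crd (\<phi> g m)) \<otimes> (g \<otimes> crd m) \<in> G0"
proof -
  interpret group G by (rule group_G)
  have "\<phi> (inv (crd (\<phi> g m)) \<otimes> (g \<otimes> crd m)) m0 = \<phi> (inv (crd (\<phi> g m))) (\<phi> g m)"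
    using assms origin crd_closed crd_act by (simp add: composition_rule)
  also have "\<dots> = m0" using act_inv[of "crd (\<phi> g m)" m0] assms origin crd_closed crd_act by simp
  finally show ?thesis using assms crd_closed unfolding G0_def stabilizer_def by simp
qed

end

context pattern_space
begin

text \<open>Translating an edge with label \<open>s\<close> changes the label to
  \<open>k <# s\<close>, where \<open>k\<close> in \<open>G0\<close> is the error of the
  coordinates; the closure of \<open>S\<close> under \<open>G0\<close> absorbs it. The left action
  is therefore by graph automorphisms.\<close>

lemma edges_act:
  assumes g: "g \<in> carrier G" and e: "(m, m') \<in> edges"
  shows "(\<phi> g m, \<phi> g m') \<in> edges"
proof -
  interpret group G by (rule group_G)
  obtain s where s: "m \<in> M" "s \<in> S" "m' = m \<lhd>\<^sub>r s" using e unfolding edges_def by blast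
  obtain a where a: "a \<in> carrier G" "s = a <# G0"
    using s(2) S_subset unfolding LCOSETS_def by blast
  define n where "n = \<phi> g m"
  define k where "k = inv (crd n) \<otimes> (g \<otimes> crd m)"
  have n: "n \<in> M" unfolding n_def using g s by simp
  have k: "k \<in> G0" unfolding k_def n_def by (rule stabilizer_of_crd[OF g s(1)])
  have c: "crd m \<in> carrier G" "crd n \<in> carrier G" "k \<in> carrier G"
    unfolding k_def using s(1) n g crd_closed by auto
  have "k <# s = (k \<otimes> a) <# G0"
    unfolding a(2) using lcos_m_assoc[of G0 k a] c a(1) G0_subgroup subgroup.subset by blast
  then have "n \<lhd>\<^sub>r (k <# s) = \<phi> (crd n \<otimes> (k \<otimes> a)) m0"
    using semi_act_coset[OF n, of "k \<otimes> a"] c a(1) by simp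
  also have "crd n \<otimes> (k \<otimes> a) = g \<otimes> (crd m \<otimes> a)"
    unfolding k_def using g c a(1) by (simp add: m_assoc[symmetric])
  also have "\<phi> \<dots> m0 = \<phi> g m'"
    using g c a(1) origin s semi_act_coset[OF s(1) a(1)] unfolding a(2)
    by (simp add: composition_rule)
  finally have "\<phi> g m' = n \<lhd>\<^sub>r (k <# s)" by simp
  moreover have "k <# s \<in> S" using G0_S k s(2) by blast
  ultimately show ?thesis using n unfolding edges_def n_def by blast
qed

lemma relpow_edges_act:
  "g \<in> carrier G \<Longrightarrow> (m, m') \<in> edges ^^ k \<Longrightarrow> (\<phi> g m, \<phi> g m') \<in> edges ^^ k"
  by (induction k arbitrary: m') (auto dest: edges_act)

lemma path_dist_relpow: "m \<in> M \<Longrightarrow> m' \<in> M \<Longrightarrow> (m, m') \<in> edges ^^ path_dist m m'"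
  unfolding path_dist_def by (rule LeastI_ex) (rule edges_connected)

lemma path_dist_le: "(m, m') \<in> edges ^^ k \<Longrightarrow> path_dist m m' \<le> k"
  unfolding path_dist_def by (rule Least_le)

lemma path_dist_self [simp]: "path_dist m m = 0"
  using path_dist_le[of m m 0] by simp

lemma path_dist_sym:
  assumes "m \<in> M" "m' \<in> M"
  shows "path_dist m m' = path_dist m' m"
proof -
  have "path_dist n' n \<le> path_dist n n'" if "n \<in> M" "n' \<in> M" for n n'
  proof -
    have "sym (edges ^^ k)" for k
    proof (induction k)
      case (Suc k)
      show ?case
      proof (rule symI)
        fix x y assume "(x, y) \<in> edges ^^ Suc k"
        then obtain z where "(x, z) \<in> edges ^^ k" "(z, y) \<in> edges" by auto
        then have "(y, z) \<in> edges" "(z, x) \<in> edges ^^ k" using Suc edges_sym by (auto dest: symD)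
        then show "(y, x) \<in> edges ^^ Suc k" by (rule relpow_Suc_I2)
      qed
    qed (simp add: sym_def)
    then have "(n', n) \<in> edges ^^ path_dist n n'" using path_dist_relpow[OF that] by (rule symD)
    then show ?thesis by (rule path_dist_le)
  qed
  then show ?thesis using assms by (simp add: order_antisym)
qed

lemma path_dist_triangle:
  assumes "l \<in> M" "m \<in> M" "n \<in> M"
  shows "path_dist l n \<le> path_dist l m + path_dist m n"
  by (rule path_dist_le) (use assms path_dist_relpow in \<open>auto simp: relpow_add\<close>)

lemma path_dist_act [simp]:
  assumes g: "g \<in> carrier G" and m: "m \<in> M" "m' \<in> M"
  shows "path_dist (\<phi> g m) (\<phi> g m') = path_dist m m'"
proof -
  interpret group G by (rule group_G)
  have le: "path_dist (\<phi> h n) (\<phi> h n') \<le> path_dist n n'"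
    if "h \<in> carrier G" "n \<in> M" "n' \<in> M" for h n n'
    by (rule path_dist_le) (use that path_dist_relpow relpow_edges_act in auto)
  show ?thesis using le[of g m m'] le[of "inv g" "\<phi> g m" "\<phi> g m'"] g m by simp
qed

lemma cell_ball_subset: "cell_ball m \<rho> \<subseteq> M"
  unfolding cell_ball_def by auto

lemma cell_ball_center: "m \<in> M \<Longrightarrow> m \<in> cell_ball m \<rho>"
  unfolding cell_ball_def by simp

lemma finite_cell_ball: assumes "m \<in> M" shows "finite (cell_ball m \<rho>)"
proof -
  have edge_image: "finite (edges `` A)" if "finite A" for A
  proof -
    have "edges `` A \<subseteq> (\<lambda>(m, s). m \<lhd>\<^sub>r s) ` (A \<times> S)" unfolding edges_def by auto
    then show ?thesis using that finite_S by (meson finite_SigmaI finite_imageI finite_subset)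
  qed
  have relpow_image: "finite ((edges ^^ k) `` {m})" for k
  proof (induction k)
    case (Suc k)
    have "(edges ^^ Suc k) `` {m} = edges `` ((edges ^^ k) `` {m})" by auto
    then show ?case using edge_image[OF Suc] by simp
  qed simp
  have "cell_ball m \<rho> \<subseteq> (\<Union>k\<le>\<rho>. (edges ^^ k) `` {m})"
    unfolding cell_ball_def using path_dist_relpow assms by auto
  then show ?thesis by (rule finite_subset) (use relpow_image in auto)
qed

lemma act_cell_ball:
  assumes g: "g \<in> carrier G" and m: "m \<in> M"
  shows "\<phi> g ` cell_ball m \<rho> = cell_ball (\<phi> g m) \<rho>"
proof (intro equalityI subsetI)
  interpret group G by (rule group_G)
  fix n assume n: "n \<in> cell_ball (\<phi> g m) \<rho>"
  then have nM: "n \<in> M" unfolding cell_ball_def by simp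
  have "\<phi> (inv g) n \<in> cell_ball m \<rho>"
    using path_dist_act[OF g m, of "\<phi> (inv g) n"] n nM g unfolding cell_ball_def by simp
  then show "n \<in> \<phi> g ` cell_ball m \<rho>" using act_act_inv[OF g nM] by force
qed (use g m in \<open>auto simp: cell_ball_def\<close>)

lemma card_cell_ball: assumes "m \<in> M" shows "card (cell_ball m \<rho>) = card (cell_ball m0 \<rho>)"
proof -
  have "cell_ball m \<rho> = \<phi> (crd m) ` cell_ball m0 \<rho>"
    using act_cell_ball[of "crd m" m0] assms origin crd_closed crd_act by simp
  moreover have "inj_on (\<phi> (crd m)) (cell_ball m0 \<rho>)"
    using inj_prop[OF crd_closed[OF assms]] cell_ball_subset inj_on_subset by blast
  ultimately show ?thesis by (simp add: card_image)
qed

lemma finite_subset_cell_ball: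
  assumes "finite A" "A \<subseteq> M"
  shows "\<exists>\<rho>. A \<subseteq> cell_ball m0 \<rho>"
proof
  show "A \<subseteq> cell_ball m0 (Max (path_dist m0 ` A))" using assms unfolding cell_ball_def by auto
qed

section \<open>Neighbourhoods of sets and their size\<close>

definition nbhd :: "'m set \<Rightarrow> nat \<Rightarrow> 'm set" where
  "nbhd A \<rho> = (\<Union>a\<in>A. cell_ball a \<rho>)"

lemma nbhd_iff: "m \<in> nbhd A \<rho> \<longleftrightarrow> m \<in> M \<and> (\<exists>a\<in>A. path_dist a m \<le> \<rho>)"
  unfolding nbhd_def cell_ball_def by auto

lemma nbhd_subset: "nbhd A \<rho> \<subseteq> M"
  by (auto simp: nbhd_iff)

lemma finite_nbhd: "finite A \<Longrightarrow> A \<subseteq> M \<Longrightarrow> finite (nbhd A \<rho>)"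
  unfolding nbhd_def using finite_cell_ball by auto

lemma subset_nbhd: "A \<subseteq> M \<Longrightarrow> A \<subseteq> nbhd A \<rho>"
  by (force simp: nbhd_iff)

lemma nbhd_mono: "A \<subseteq> B \<Longrightarrow> \<rho> \<le> \<sigma> \<Longrightarrow> nbhd A \<rho> \<subseteq> nbhd B \<sigma>"
  unfolding subset_iff nbhd_iff by (meson le_trans)

lemma nbhd_nbhd:
  assumes "A \<subseteq> M"
  shows "nbhd (nbhd A \<rho>) \<sigma> \<subseteq> nbhd A (\<rho> + \<sigma>)"
proof
  fix m assume "m \<in> nbhd (nbhd A \<rho>) \<sigma>"
  then obtain b a where ab: "m \<in> M" "b \<in> M" "a \<in> A" "path_dist a b \<le> \<rho>" "path_dist b m \<le> \<sigma>"
    unfolding nbhd_iff[of m] by (auto simp: nbhd_iff)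
  then have "path_dist a m \<le> \<rho> + \<sigma>"
    using path_dist_triangle[of a b m] assms by auto
  then show "m \<in> nbhd A (\<rho> + \<sigma>)" using ab unfolding nbhd_iff by blast
qed

lemma card_nbhd_le:
  assumes "finite A" "A \<subseteq> M"
  shows "card (nbhd A \<rho>) \<le> card A * card (cell_ball m0 \<rho>)"
proof -
  have "card (nbhd A \<rho>) \<le> (\<Sum>a\<in>A. card (cell_ball a \<rho>))"
    unfolding nbhd_def using assms(1) by (rule card_UN_le)
  also have "\<dots> = (\<Sum>a\<in>A. card (cell_ball m0 \<rho>))"
    by (rule sum.cong) (use assms(2) card_cell_ball in auto)
  finally show ?thesis by simp
qed

section \<open>Foelner sets\<close>

text \<open>Splitting \<open>M\<close> according to the coset that realises the displacement of \<open>f\<close> turns \<open>f\<close> into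
  finitely many semi-translations.\<close>

lemma invariant_mean_bounded_displacement:
  fixes \<mu> :: "'m set \<Rightarrow> real"
  assumes add: "\<And>A B. A \<subseteq> M \<Longrightarrow> B \<subseteq> M \<Longrightarrow> A \<inter> B = {} \<Longrightarrow> \<mu> (A \<union> B) = \<mu> A + \<mu> B"
    and invariant: "\<And>c A. c \<in> lcosets G0 \<Longrightarrow> A \<subseteq> M \<Longrightarrow> inj_on (\<lambda>m. m \<lhd>\<^sub>r c) A \<Longrightarrow>
        \<mu> ((\<lambda>m. m \<lhd>\<^sub>r c) ` A) = \<mu> A"
    and f: "inj_on f M" "\<And>m. m \<in> M \<Longrightarrow> f m \<in> cell_ball m \<rho>"
  shows "\<mu> (f ` M) = \<mu> M"
proof -
  have empty: "\<mu> {} = 0" using add[of "{}" "{}"] by simp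
  have UN: "\<mu> (\<Union>(A ` I)) = (\<Sum>i\<in>I. \<mu> (A i))"
    if "finite I" "\<And>i. A i \<subseteq> M" "disjoint_family_on A I" for I :: "'m set" and A
    using that(1,3)
  proof (induction I)
    case (insert i I)
    have "\<mu> (A i \<union> \<Union>(A ` I)) = \<mu> (A i) + \<mu> (\<Union>(A ` I))"
      using insert that(2) by (intro add) (auto simp: disjoint_family_on_def)
    also have "disjoint_family_on A I"
      using insert.prems by (rule disjoint_family_on_mono[rotated]) auto
    then have "\<mu> (\<Union>(A ` I)) = (\<Sum>i\<in>I. \<mu> (A i))" by (rule insert.IH)
    finally show ?case using insert by simp
  qed (simp add: empty)
  define C where "C n = {m \<in> M. \<phi> (inv (crd m)) (f m) = n}" for n
  define B where "B = cell_ball m0 \<rho>"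
  have fM: "f m \<in> M" if "m \<in> M" for m using f(2)[OF that] cell_ball_subset by blast
  \<comment> \<open>Undoing the coordinate carries the ball around \<open>m\<close> to the ball
    around \<open>m0\<close>, so only the finitely many displacements in \<open>B\<close>
    occur.\<close>
  have inB: "\<phi> (inv (crd m)) (f m) \<in> B" if m: "m \<in> M" for m
  proof -
    interpret group G by (rule group_G)
    have "\<phi> (inv (crd m)) m = m0" using act_inv[of "crd m" m0] m origin crd_closed crd_act by simp
    then have "\<phi> (inv (crd m)) ` cell_ball m \<rho> = B"
      unfolding B_def using act_cell_ball[of "inv (crd m)" m] m crd_closed by simp
    then show ?thesis using f(2)[OF m] by blast
  qed
  have BM: "B \<subseteq> M" unfolding B_def by (rule cell_ball_subset)
  have C: "C n \<subseteq> M" for n unfolding C_def by auto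
  have M: "M = \<Union>(C ` B)" unfolding C_def using inB by auto
  have fC: "\<mu> (f ` C n) = \<mu> (C n)" if n: "n \<in> B" for n
  proof -
    have "n \<in> M" using n BM by blast
    then have eq: "m \<lhd>\<^sub>r coset_of n = f m" if "m \<in> C n" for m
      using that semi_act_coset_of[of m n] act_act_inv[of "crd m" "f m"] fM crd_closed
      unfolding C_def by auto
    have "coset_of n \<in> lcosets G0"
      using coset_of_eq[OF \<open>n \<in> M\<close>] crd_closed[OF \<open>n \<in> M\<close>] unfolding LCOSETS_def by blast
    moreover have "inj_on (\<lambda>m. m \<lhd>\<^sub>r coset_of n) (C n)"
      using inj_on_subset[OF f(1) C] eq by (simp cong: inj_on_cong)
    ultimately have "\<mu> ((\<lambda>m. m \<lhd>\<^sub>r coset_of n) ` C n) = \<mu> (C n)" by (intro invariant C)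
    then show ?thesis using eq by (simp cong: image_cong)
  qed
  have finB: "finite B" unfolding B_def using finite_cell_ball origin by blast
  have disj: "disjoint_family_on C B" unfolding disjoint_family_on_def C_def by auto
  have "\<mu> (f ` M) = \<mu> (\<Union>((\<lambda>n. f ` C n) ` B))" by (subst M) (simp add: image_UN)
  also have "\<dots> = (\<Sum>n\<in>B. \<mu> (f ` C n))"
  proof (rule UN[OF finB])
    show "f ` C n \<subseteq> M" for n using C fM by blast
    show "disjoint_family_on (\<lambda>n. f ` C n) B"
      using disj f(1) C unfolding disjoint_family_on_def
      by (metis image_empty inj_on_image_Int)
  qed
  also have "\<dots> = (\<Sum>n\<in>B. \<mu> (C n))" using fC by simp
  also have "\<dots> = \<mu> (\<Union>(C ` B))" by (rule UN[OF finB C disj, symmetric])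
  finally show ?thesis using M by simp
qed

lemma no_doubling:
  assumes "right_amenable"
  shows "\<exists>F. finite F \<and> F \<subseteq> M \<and> card (nbhd F \<rho>) < 2 * card F"
proof (rule ccontr)
  assume "\<not> ?thesis"
  then have dbl: "2 * card F \<le> card (nbhd F \<rho>)" if "finite F" "F \<subseteq> M" for F
    using that not_less by blast
  \<comment> \<open>An injection of two copies of \<open>M\<close> is a pair of injections with
    disjoint images. At most two elements of \<open>J\<close> lie over each cell, so doubling is
    exactly Hall's condition.\<close>
  have "\<exists>f. inj_on f (M \<times> (UNIV :: bool set)) \<and> (\<forall>i\<in>M \<times> UNIV. f i \<in> cell_ball (fst i) \<rho>)"
  proof (rule locally_finite_Hall)
    show "finite (cell_ball (fst i) \<rho>)" if "i \<in> M \<times> (UNIV :: bool set)" for i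
      using that finite_cell_ball by auto
    show "card J \<le> card (\<Union>i\<in>J. cell_ball (fst i) \<rho>)"
      if J: "finite J" "J \<subseteq> M \<times> (UNIV :: bool set)" for J
    proof -
      have "J \<subseteq> fst ` J \<times> UNIV" by force
      then have "card J \<le> card (fst ` J \<times> (UNIV :: bool set))"
        using J(1) by (intro card_mono) auto
      also have "\<dots> = 2 * card (fst ` J)" by (simp add: card_cartesian_product)
      also have "\<dots> \<le> card (nbhd (fst ` J) \<rho>)" using J by (intro dbl) auto
      finally show ?thesis unfolding nbhd_def by simp
    qed
  qed
  then obtain f where f: "inj_on f (M \<times> (UNIV :: bool set))"
    "\<And>m b. m \<in> M \<Longrightarrow> f (m, b) \<in> cell_ball m \<rho>" by force
  obtain \<mu> :: "'m set \<Rightarrow> real" where \<mu>: "\<And>A. A \<subseteq> M \<Longrightarrow> 0 \<le> \<mu> A" "\<mu> M = 1"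
    "\<And>A B. A \<subseteq> M \<Longrightarrow> B \<subseteq> M \<Longrightarrow> A \<inter> B = {} \<Longrightarrow> \<mu> (A \<union> B) = \<mu> A + \<mu> B"
    "\<And>c A. c \<in> lcosets G0 \<Longrightarrow> A \<subseteq> M \<Longrightarrow> inj_on (\<lambda>m. m \<lhd>\<^sub>r c) A \<Longrightarrow>
        \<mu> ((\<lambda>m. m \<lhd>\<^sub>r c) ` A) = \<mu> A"
    using assms unfolding right_amenable_def by metis
  define A where "A b = (\<lambda>m. f (m, b)) ` M" for b
  have A: "A b \<subseteq> M" for b unfolding A_def using f(2) cell_ball_subset by blast
  have one: "\<mu> (A b) = 1" for b
    unfolding A_def \<mu>(2)[symmetric]
    by (rule invariant_mean_bounded_displacement[OF \<mu>(3,4), where \<rho> = \<rho>])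
      (use f in \<open>auto simp: inj_on_def\<close>)
  have "A True \<inter> A False = {}" using f(1) unfolding A_def inj_on_def by auto
  then have "\<mu> (A True \<union> A False) = 2" using \<mu>(3)[OF A A] one by simp
  moreover have "\<mu> M = \<mu> (A True \<union> A False) + \<mu> (M - (A True \<union> A False))"
    using \<mu>(3)[of "A True \<union> A False" "M - (A True \<union> A False)"] A by (simp add: Un_absorb1)
  moreover have "0 \<le> \<mu> (M - (A True \<union> A False))" by (rule \<mu>(1)) auto
  ultimately show False using \<mu>(2) by simp
qed

text \<open>A failure gives growth by only \<open>1 + \<epsilon>\<close> at radius
  \<open>\<rho>\<close>. It compounds to growth by \<open>(1 + \<epsilon>) ^ n\<close> at radius
  \<open>n * \<rho>\<close>, which exceeds 2 for large \<open>n\<close> and contradicts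
  \<open>no_doubling\<close> at that radius.\<close>

lemma Foelner:
  fixes \<epsilon> :: real
  assumes "right_amenable" "\<epsilon> > 0"
  shows "\<exists>F. finite F \<and> F \<subseteq> M \<and> F \<noteq> {} \<and> real (card (nbhd F \<rho>)) \<le> (1 + \<epsilon>) * real (card F)"
proof (rule ccontr)
  assume "\<not> ?thesis"
  then have grow: "(1 + \<epsilon>) * real (card F) \<le> real (card (nbhd F \<rho>))" if "finite F" "F \<subseteq> M" for F
    using that by (cases "F = {}") (auto simp: not_le intro: less_imp_le)
  have grow_power: "(1 + \<epsilon>) ^ n * real (card F) \<le> real (card (nbhd F (n * \<rho>)))"
    if F: "finite F" "F \<subseteq> M" for F n
  proof (induction n)
    case 0
    show ?case using card_mono[OF finite_nbhd[OF F] subset_nbhd[OF F(2)], of 0] by simp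
  next
    case (Suc n)
    have "(1 + \<epsilon>) ^ Suc n * real (card F) \<le> (1 + \<epsilon>) * real (card (nbhd F (n * \<rho>)))"
      using Suc assms(2) by (simp add: mult.assoc)
    also have "\<dots> \<le> real (card (nbhd (nbhd F (n * \<rho>)) \<rho>))"
      using F finite_nbhd nbhd_subset by (intro grow) auto
    also have "\<dots> \<le> real (card (nbhd F (Suc n * \<rho>)))"
      using nbhd_nbhd[OF F(2), of "n * \<rho>" \<rho>] F
      by (intro of_nat_mono card_mono finite_nbhd) (auto simp: add.commute)
    finally show ?case .
  qed
  obtain n where n: "2 < (1 + \<epsilon>) ^ n" using real_arch_pow[of "1 + \<epsilon>" 2] assms(2) by auto
  obtain F where F: "finite F" "F \<subseteq> M" "card (nbhd F (n * \<rho>)) < 2 * card F"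
    using no_doubling[OF assms(1)] by blast
  have "2 * real (card F) \<le> (1 + \<epsilon>) ^ n * real (card F)"
    using n by (intro mult_right_mono) auto
  also have "\<dots> \<le> real (card (nbhd F (n * \<rho>)))" by (rule grow_power[OF F(1,2)])
  also have "\<dots> < real (2 * card F)" using F(3) by (rule of_nat_less_iff[THEN iffD2])
  finally show False by simp
qed

section \<open>Separated centres of positive density\<close>

definition separated :: "nat \<Rightarrow> 'm set \<Rightarrow> bool" where
  "separated \<sigma> T \<longleftrightarrow> (\<forall>s\<in>T. \<forall>t\<in>T. s \<noteq> t \<longrightarrow> \<sigma> < path_dist s t)"

text \<open>A maximal separated subset covers, since a cell of \<open>F\<close> farther than
  \<open>\<sigma>\<close> from it could be added.\<close>

lemma separated_covering_subset:
  assumes F: "finite F" "F \<subseteq> M"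
  shows "\<exists>T \<subseteq> F. separated \<sigma> T \<and> F \<subseteq> nbhd T \<sigma>"
proof -
  define \<T> where "\<T> = {T. T \<subseteq> F \<and> separated \<sigma> T}"
  have "finite \<T>" "{} \<in> \<T>" using F(1) unfolding \<T>_def separated_def by auto
  then obtain T where T: "T \<in> \<T>" "\<And>T'. T' \<in> \<T> \<Longrightarrow> T \<subseteq> T' \<Longrightarrow> T = T'"
    using finite_has_maximal[of \<T>] by blast
  have "m \<in> nbhd T \<sigma>" if m: "m \<in> F" for m
  proof (rule ccontr)
    assume no: "m \<notin> nbhd T \<sigma>"
    have mM: "m \<in> M" and TF: "T \<subseteq> F" using m F T(1) unfolding \<T>_def by auto
    then have far: "\<sigma> < path_dist t m" "\<sigma> < path_dist m t" if "t \<in> T" for t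
    proof -
      have tM: "t \<in> M" using that TF F(2) by blast
      show "\<sigma> < path_dist t m" using no that mM unfolding nbhd_iff by (auto simp: not_le)
      then show "\<sigma> < path_dist m t" using path_dist_sym[OF tM mM] by simp
    qed
    have "insert m T \<in> \<T>" using T(1) m far unfolding \<T>_def separated_def by auto
    then have "m \<in> T" using T(2) by blast
    then show False using no subset_nbhd[of T] TF F(2) by blast
  qed
  with T(1) show ?thesis unfolding \<T>_def by blast
qed

text \<open>The exponential gain at the centres \<open>T\<close>, which have positive density in \<open>F\<close>, beats the
  boundary term.\<close>

lemma Foelner_packing:
  fixes a c :: real
  assumes amenable: "right_amenable" and a: "0 < a" "a < 1" and c: "1 \<le> c"
  shows "\<exists>F T. finite F \<and> F \<subseteq> M \<and> T \<subseteq> F \<and> separated \<sigma> T \<and>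
    a ^ card T * c ^ card (nbhd F \<rho> - F) < 1"
proof -
  define b where "b = card (cell_ball m0 \<sigma>)"
  have b: "0 < b"
    unfolding b_def using finite_cell_ball cell_ball_center origin by (fastforce simp: card_gt_0_iff)
  \<comment> \<open>Chosen so that \<open>\<epsilon> * b * (ln c + 1)\<close> is half of
    \<open>- ln a\<close>. As the covering gives \<open>card F \<le> t * b\<close>, the boundary
    then costs at most half of the gain at the centres. The \<open>+ 1\<close> keeps the denominator
    positive for \<open>c = 1\<close>.\<close>
  define \<epsilon> where "\<epsilon> = - ln a / (2 * b * (ln c + 1))"
  have lnc: "0 \<le> ln c" and lna: "ln a < 0" using a c by auto
  have \<epsilon>: "0 < \<epsilon>" unfolding \<epsilon>_def using lnc lna b by (intro divide_pos_pos) auto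
  obtain F where F: "finite F" "F \<subseteq> M" "F \<noteq> {}"
    "real (card (nbhd F \<rho>)) \<le> (1 + \<epsilon>) * real (card F)"
    using Foelner[OF amenable \<epsilon>] by blast
  obtain T where T: "T \<subseteq> F" "separated \<sigma> T" "F \<subseteq> nbhd T \<sigma>"
    using separated_covering_subset[OF F(1,2)] by blast
  have finT: "finite T" "T \<subseteq> M" using T(1) F(1,2) by (auto intro: finite_subset)
  define t where "t = card T"
  define k where "k = card (nbhd F \<rho> - F)"
  have "card F \<le> card (nbhd T \<sigma>)" using T(3) finite_nbhd[OF finT] by (intro card_mono) auto
  also have "\<dots> \<le> t * b" unfolding t_def b_def by (rule card_nbhd_le[OF finT])
  finally have FT: "real (card F) \<le> real t * real b" by (metis of_nat_le_iff of_nat_mult)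
  have Fpos: "0 < card F" using F by (simp add: card_gt_0_iff)
  have tpos: "0 < t" using FT Fpos by (cases t) auto
  have "card (nbhd F \<rho>) = k + card F"
    unfolding k_def using card_Diff_subset[OF F(1) subset_nbhd[OF F(2)], of \<rho>]
      card_mono[OF finite_nbhd[OF F(1,2)] subset_nbhd[OF F(2)], of \<rho>] by simp
  then have "real k \<le> \<epsilon> * real (card F)" using F(4) by (simp add: algebra_simps)
  also have "\<dots> \<le> \<epsilon> * (real t * real b)" using FT \<epsilon> by (intro mult_left_mono) auto
  finally have "real k * (ln c + 1) \<le> \<epsilon> * (real t * real b) * (ln c + 1)"
    using lnc by (intro mult_right_mono) auto
  also have "\<dots> = real t * (- ln a) / 2"
  proof -
    have "\<epsilon> * (real t * real b) * (ln c + 1) = real t * (\<epsilon> * (2 * b * (ln c + 1))) / 2"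
      by (simp add: algebra_simps)
    also have "\<epsilon> * (2 * b * (ln c + 1)) = - ln a" unfolding \<epsilon>_def using b lnc by simp
    finally show ?thesis .
  qed
  also have "\<dots> < real t * (- ln a)" using tpos lna by simp
  finally have "real k * ln c + real t * ln a < 0" by (simp add: algebra_simps)
  moreover have "ln (a ^ t * c ^ k) = real k * ln c + real t * ln a"
    using a c by (simp add: ln_mult ln_realpow)
  ultimately have "a ^ t * c ^ k < 1"
    using a c by (metis ln_less_zero_iff mult_pos_pos zero_less_power less_le_trans zero_less_one)
  then show ?thesis using F T unfolding t_def k_def by blast
qed

section \<open>Subshifts and local maps\<close>

lemma H_carrier: "h \<in> H \<Longrightarrow> h \<in> carrier G"
  using H_subgroup subgroup.subset by blast

lemma pat_act_apply [simp]: "h \<in> carrier G \<Longrightarrow> m \<in> M \<Longrightarrow> pat_act h p (\<phi> h m) = p m"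
  unfolding pat_act_def by simp

lemma patterns_value: "p \<in> patterns A \<Longrightarrow> m \<in> A \<Longrightarrow> p m \<in> Some ` Q"
  unfolding patterns_def using ranI[of p m] by (cases "p m") (auto simp: domIff)

lemma patterns_outside: "p \<in> patterns A \<Longrightarrow> m \<notin> A \<Longrightarrow> p m = None"
  unfolding patterns_def by (auto simp: domIff)

lemma patternsI:
  assumes "\<And>m. m \<in> A \<Longrightarrow> p m \<in> Some ` Q" and "\<And>m. m \<notin> A \<Longrightarrow> p m = None"
  shows "p \<in> patterns A"
proof -
  have "m \<in> dom p \<longleftrightarrow> m \<in> A" for m using assms[of m] by (cases "m \<in> A") (auto simp: domIff)
  moreover have "v \<in> Q" if "p m = Some v" for m v
    using assms[of m] that by (cases "m \<in> A") auto
  ultimately show ?thesis unfolding patterns_def ran_def by auto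
qed

lemma finite_patterns_iff:
  "p \<in> finite_patterns \<longleftrightarrow> finite (dom p) \<and> dom p \<subseteq> M \<and> ran p \<subseteq> Q"
  unfolding finite_patterns_def patterns_def by auto

lemma pat_act_patterns: "h \<in> carrier G \<Longrightarrow> x \<in> patterns M \<Longrightarrow> pat_act h x \<in> patterns M"
  using group.inv_closed[OF group_G]
  by (intro patternsI) (simp_all add: pat_act_def patterns_value)

lemma pat_act_inv:
  assumes h: "h \<in> carrier G" and x: "x \<in> patterns M"
  shows "pat_act h (pat_act (inv h) x) = x"
proof
  fix m
  have "x m = None" if "m \<notin> M" using x that by (rule patterns_outside)
  then show "pat_act h (pat_act (inv h) x) m = x m"
    using pat_act_apply[of "inv h" m x] h group.inv_closed[OF group_G h]
    by (cases "m \<in> M") (auto simp: pat_act_def)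
qed

lemma semi_occurs_iff:
  assumes p: "dom p \<subseteq> M"
  shows "semi_occurs p c \<longleftrightarrow> (\<exists>h\<in>H. \<forall>m\<in>dom p. c (\<phi> h m) = p m)"
proof -
  have "\<phi> h ` dom p \<subseteq> dom c \<and> pat_act h p = c |` (\<phi> h ` dom p) \<longleftrightarrow>
      (\<forall>m\<in>dom p. c (\<phi> h m) = p m)" (is "?L \<longleftrightarrow> ?R") if "h \<in> H" for h
  proof
    have h: "h \<in> carrier G" using that by (rule H_carrier)
    { assume L: ?L
      show ?R
      proof
        fix m assume m: "m \<in> dom p"
        then have "pat_act h p (\<phi> h m) = p m" using p h by auto
        then show "c (\<phi> h m) = p m" using L m by simp
      qed }
    { assume R: ?R
      have "pat_act h p n = (c |` (\<phi> h ` dom p)) n" for n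
      proof (cases "n \<in> \<phi> h ` dom p")
        case True
        then obtain m where m: "m \<in> dom p" "n = \<phi> h m" by blast
        then have "pat_act h p n = p m" using p h by auto
        also have "p m = c n" using R m by simp
        finally show ?thesis using True by simp
      next
        case False
        have "\<phi> (inv h) n \<notin> dom p" if "n \<in> M"
        proof
          assume "\<phi> (inv h) n \<in> dom p"
          then have "\<phi> h (\<phi> (inv h) n) \<in> \<phi> h ` dom p" by (rule imageI)
          then show False using False that h by simp
        qed
        then show ?thesis using False unfolding pat_act_def by (auto simp: domIff)
      qed
      moreover have "\<phi> h ` dom p \<subseteq> dom c" using R by (auto simp: domIff)
      ultimately show ?L by blast }
  qed
  then show ?thesis unfolding semi_occurs_def by blast
qed

lemma avoiding_iff:
  assumes "F \<subseteq> finite_patterns"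
  shows "c \<in> avoiding F \<longleftrightarrow> c \<in> patterns M \<and> (\<forall>f\<in>F. \<forall>h\<in>H. \<exists>m\<in>dom f. c (\<phi> h m) \<noteq> f m)"
proof -
  have "dom f \<subseteq> M" if "f \<in> F" for f using that assms finite_patterns_iff by blast
  then show ?thesis unfolding avoiding_def using semi_occurs_iff by auto
qed

lemma subshift_patterns: "subshift X \<Longrightarrow> X \<subseteq> patterns M"
  unfolding subshift_def avoiding_def by auto

text \<open>An occurrence of a forbidden pattern in the translate by means of \<open>h\<close> is
  one in \<open>x\<close> by means of \<open>inv g \<otimes> h\<close>, again in \<open>H\<close>.
  Semi-occurrence ranges over \<open>H\<close>, hence the restriction to \<open>g\<close> in
  \<open>H\<close>.\<close>

lemma subshift_pat_act:
  assumes X: "subshift X" and x: "x \<in> X" and g: "g \<in> H"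
  shows "pat_act g x \<in> X"
proof -
  interpret group G by (rule group_G)
  obtain F where F: "F \<subseteq> finite_patterns" "X = avoiding F" using X unfolding subshift_def by blast
  have "\<exists>m\<in>dom f. pat_act g x (\<phi> h m) \<noteq> f m" if f: "f \<in> F" and h: "h \<in> H" for f h
  proof -
    have "inv g \<otimes> h \<in> H" using g h H_subgroup by (simp add: subgroup.m_closed subgroup.m_inv_closed)
    then obtain m where m: "m \<in> dom f" "x (\<phi> (inv g \<otimes> h) m) \<noteq> f m"
      using x f unfolding F(2) avoiding_iff[OF F(1)] by blast
    have "m \<in> M" using m f F(1) finite_patterns_iff by blast
    then have "pat_act g x (\<phi> h m) = x (\<phi> (inv g \<otimes> h) m)"
      using g h H_carrier unfolding pat_act_def by (simp add: composition_rule)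
    then show ?thesis using m by metis
  qed
  then show ?thesis
    using x pat_act_patterns[OF H_carrier[OF g]] unfolding F(2) avoiding_iff[OF F(1)] by blast
qed

text \<open>Closedness in the prodiscrete topology: an occurrence of a forbidden pattern is visible
  on a finite set.\<close>

lemma subshift_closed:
  assumes X: "subshift X" and y: "y \<in> patterns M"
    and approx: "\<And>A. finite A \<Longrightarrow> A \<subseteq> M \<Longrightarrow> \<exists>x\<in>X. \<forall>m\<in>A. x m = y m"
  shows "y \<in> X"
proof -
  obtain F where F: "F \<subseteq> finite_patterns" "X = avoiding F" using X unfolding subshift_def by blast
  have "\<exists>m\<in>dom f. y (\<phi> h m) \<noteq> f m" if f: "f \<in> F" and h: "h \<in> H" for f h
  proof -
    have "finite (dom f)" "dom f \<subseteq> M" using f F(1) finite_patterns_iff by auto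
    then have "finite (\<phi> h ` dom f)" "\<phi> h ` dom f \<subseteq> M" using H_carrier[OF h] by auto
    then obtain x where x: "x \<in> X" "\<forall>m\<in>\<phi> h ` dom f. x m = y m"
      using approx by meson
    then obtain m where m: "m \<in> dom f" "x (\<phi> h m) \<noteq> f m"
      using f h unfolding F(2) avoiding_iff[OF F(1)] by blast
    then have "x (\<phi> h m) = y (\<phi> h m)" using x(2) by blast
    then show ?thesis using m by metis
  qed
  then show ?thesis using y unfolding F(2) avoiding_iff[OF F(1)] by blast
qed

text \<open>A window of diameter at most \<open>r\<close> that meets \<open>D\<close> stays within distance \<open>r\<close> of \<open>D\<close>, where
  the spliced configuration coincides with \<open>x\<close>; the other windows only see \<open>y\<close>.\<close>

lemma finite_type_splice:
  assumes "finite_type X"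
  shows "\<exists>r. \<forall>D x y. D \<subseteq> M \<longrightarrow> x \<in> X \<longrightarrow> y \<in> X \<longrightarrow> (\<forall>m\<in>nbhd D r - D. x m = y m) \<longrightarrow>
    override_on y x D \<in> X"
proof -
  obtain F where F: "F \<subseteq> finite_patterns" "finite F" "X = avoiding F"
    using assms unfolding finite_type_def by blast
  have dom: "finite (dom f)" "dom f \<subseteq> M" if "f \<in> F" for f
    using that F(1) finite_patterns_iff by auto
  define L where "L = (\<Union>f\<in>F. (\<lambda>(a, b). path_dist a b) ` (dom f \<times> dom f))"
  have finL: "finite L" unfolding L_def using F(2) dom by auto
  \<comment> \<open>A bound on the diameters of the forbidden domains, available because
    \<open>F\<close> is finite; \<open>0\<close> covers the case of empty \<open>L\<close>.\<close>
  define r where "r = Max (insert 0 L)"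
  have r: "path_dist a b \<le> r" if "f \<in> F" "a \<in> dom f" "b \<in> dom f" for f a b
    unfolding r_def using that finL by (intro Max_ge) (auto simp: L_def)
  have "override_on y x D \<in> X"
    if D: "D \<subseteq> M" and x: "x \<in> X" and y: "y \<in> X" and ring: "\<forall>m\<in>nbhd D r - D. x m = y m" for D x y
  proof -
    have "\<exists>m\<in>dom f. override_on y x D (\<phi> h m) \<noteq> f m" if f: "f \<in> F" and h: "h \<in> H" for f h
    proof (cases "\<phi> h ` dom f \<inter> D = {}")
      case True
      obtain m where m: "m \<in> dom f" "y (\<phi> h m) \<noteq> f m"
        using y f h unfolding F(3) avoiding_iff[OF F(1)] by blast
      then have "override_on y x D (\<phi> h m) = y (\<phi> h m)" using True by (auto simp: override_on_def)
      then show ?thesis using m by metis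
    next
      case False
      then obtain a where a: "a \<in> dom f" "\<phi> h a \<in> D" by blast
      obtain m where m: "m \<in> dom f" "x (\<phi> h m) \<noteq> f m"
        using x f h unfolding F(3) avoiding_iff[OF F(1)] by blast
      have am: "a \<in> M" "m \<in> M" using a m dom(2)[OF f] by auto
      then have "path_dist (\<phi> h a) (\<phi> h m) \<le> r"
        using r[OF f a(1) m(1)] H_carrier[OF h] by simp
      then have "\<phi> h m \<in> nbhd D r"
        using a(2) am H_carrier[OF h] unfolding nbhd_iff by (meson act_closed)
      then have "override_on y x D (\<phi> h m) = x (\<phi> h m)"
        using ring by (auto simp: override_on_def)
      then show ?thesis using m by metis
    qed
    moreover have "x \<in> patterns M" "y \<in> patterns M" using x y unfolding F(3) avoiding_def by auto
    then have "override_on y x D \<in> patterns M"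
      by (intro patternsI) (auto simp: override_on_def patterns_value patterns_outside)
    ultimately show ?thesis unfolding F(3) avoiding_iff[OF F(1)] by blast
  qed
  then show ?thesis by blast
qed

section \<open>Gluing configurations\<close>

text \<open>Restrictions of elements of \<open>X\<close> are allowed by way of the identity of
  \<open>H\<close>, so the definition applies to them. If \<open>A\<close> or \<open>B\<close> is
  empty, \<open>set_dist\<close> is infinite and the distance condition still holds.\<close>

lemma strongly_irreducible_glue:
  assumes SI: "strongly_irreducible_with \<kappa> X" and X: "subshift X"
    and x: "x \<in> X" and y: "y \<in> X"
    and A: "finite A" "A \<subseteq> M" and B: "finite B" "B \<subseteq> M"
    and far: "\<And>a b. a \<in> A \<Longrightarrow> b \<in> B \<Longrightarrow> \<kappa> < path_dist a b"
  shows "\<exists>z\<in>X. (\<forall>m\<in>A. z m = x m) \<and> (\<forall>m\<in>B. z m = y m)"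
proof -
  interpret group G by (rule group_G)
  have dom: "dom (w |` C) = C" if "w \<in> X" "C \<subseteq> M" for w C
    using that subshift_patterns[OF X] unfolding patterns_def by auto
  have fin: "w |` C \<in> finite_patterns" if w: "w \<in> X" "finite C" "C \<subseteq> M" for w C
  proof -
    have "ran (w |` C) \<subseteq> ran w" unfolding ran_def restrict_map_def by (auto split: if_splits)
    also have "ran w \<subseteq> Q" using w(1) subshift_patterns[OF X] unfolding patterns_def by auto
    finally show ?thesis unfolding finite_patterns_iff dom[OF w(1,3)] using w(2,3) by simp
  qed
  have allowed: "allowed X (w |` C)" if w: "w \<in> X" "C \<subseteq> M" for w C
  proof -
    have "\<phi> \<one> m = m" if "m \<in> M" for m using id_eq_one that by (metis restrict_apply')
    then have "\<forall>m\<in>dom (w |` C). w (\<phi> \<one> m) = (w |` C) m" using w(2) unfolding dom[OF w] by auto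
    then have "semi_occurs (w |` C) w"
      using semi_occurs_iff[of "w |` C" w] dom[OF w] w(2) subgroup.one_closed[OF H_subgroup] by blast
    then show ?thesis unfolding allowed_def using w by blast
  qed
  have "enat (\<kappa> + 1) \<le> set_dist A B"
    unfolding set_dist_def by (rule Inf_greatest) (use far in \<open>auto simp: Suc_le_eq\<close>)
  then obtain z where z: "z \<in> X" "z |` A = x |` A" "z |` B = y |` B"
    using SI[unfolded strongly_irreducible_with_def, rule_format, of "x |` A" "y |` B"]
      fin[OF x A] fin[OF y B] allowed[OF x A(2)] allowed[OF y B(2)] dom[OF x A(2)] dom[OF y B(2)]
    by auto
  then show ?thesis by (metis restrict_in)
qed

text \<open>Only finite patterns can be glued, so \<open>y\<close> is first prescribed on a finite
  ring of width \<open>r\<close> around \<open>W = nbhd A \<kappa>\<close>. Finite type then allows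
  the glued configuration to be kept on \<open>W\<close> and replaced by \<open>y\<close> everywhere
  else.\<close>

lemma strongly_irreducible_finite_type_glue:
  assumes SI: "strongly_irreducible_with \<kappa> X" and X: "subshift X" and SFT: "finite_type X"
    and x: "x \<in> X" and y: "y \<in> X" and A: "finite A" "A \<subseteq> M"
  shows "\<exists>z\<in>X. (\<forall>m\<in>A. z m = x m) \<and> (\<forall>m. m \<notin> nbhd A \<kappa> \<longrightarrow> z m = y m)"
proof -
  obtain r where r: "\<And>D x y. D \<subseteq> M \<Longrightarrow> x \<in> X \<Longrightarrow> y \<in> X \<Longrightarrow> \<forall>m\<in>nbhd D r - D. x m = y m \<Longrightarrow>
    override_on y x D \<in> X"
    using finite_type_splice[OF SFT] by blast
  define W where "W = nbhd A \<kappa>"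
  have W: "finite W" "W \<subseteq> M" unfolding W_def using finite_nbhd[OF A] nbhd_subset by auto
  have AW: "A \<subseteq> W" unfolding W_def by (rule subset_nbhd[OF A(2)])
  have "\<exists>z\<in>X. (\<forall>m\<in>A. z m = x m) \<and> (\<forall>m\<in>nbhd W r - W. z m = y m)"
  proof (rule strongly_irreducible_glue[OF SI X x y A])
    show "finite (nbhd W r - W)" using finite_nbhd[OF W] by simp
    show "nbhd W r - W \<subseteq> M" using nbhd_subset by auto
    show "\<kappa> < path_dist a b" if "a \<in> A" "b \<in> nbhd W r - W" for a b
      using that nbhd_subset unfolding W_def by (auto simp: nbhd_iff not_le)
  qed
  then obtain z where z: "z \<in> X" "\<forall>m\<in>A. z m = x m" "\<forall>m\<in>nbhd W r - W. z m = y m" by blast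
  have "override_on y z W \<in> X" by (rule r[OF W(2) z(1) y z(3)])
  moreover have "\<forall>m\<in>A. override_on y z W m = x m" using AW z(2) by (auto simp: override_on_def)
  ultimately show ?thesis unfolding W_def by (auto simp: override_on_def)
qed

section \<open>Local maps\<close>

text \<open>The cell read in direction \<open>n\<close> is \<open>\<phi> (crd m) n\<close>, and
  \<open>crd m\<close> carries the ball around \<open>m0\<close> that contains \<open>N\<close> to
  the ball around \<open>m\<close>.\<close>

lemma local_with_cong:
  assumes loc: "local_with k X Y \<Delta>" and x: "x \<in> X" "y \<in> X" and m: "m \<in> M"
    and eq: "\<And>n. n \<in> cell_ball m k \<Longrightarrow> x n = y n"
  shows "\<Delta> x m = \<Delta> y m"
proof -
  obtain N \<delta> where N: "N \<subseteq> cell_ball m0 k"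
    "\<forall>x\<in>X. \<forall>m\<in>M.
        \<Delta> x m = Some (\<delta> (\<lambda>n. if n \<in> N then x (m \<lhd>\<^sub>r coset_of n) else None))"
    using loc unfolding local_with_def by (elim conjE exE) (rule that)
  have "m \<lhd>\<^sub>r coset_of n \<in> cell_ball m k" if "n \<in> N" for n
  proof -
    have n: "n \<in> cell_ball m0 k" "n \<in> M" using that N(1) cell_ball_subset by auto
    have "\<phi> (crd m) n \<in> cell_ball m k"
      using act_cell_ball[of "crd m" m0 k] n(1) origin m crd_closed crd_act by auto
    then show ?thesis using semi_act_coset_of[OF m n(2)] by simp
  qed
  then have "(\<lambda>n. if n \<in> N then x (m \<lhd>\<^sub>r coset_of n) else None) =
      (\<lambda>n. if n \<in> N then y (m \<lhd>\<^sub>r coset_of n) else None)"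
    using eq by auto
  then show ?thesis
    unfolding N(2)[rule_format, OF x(1) m] N(2)[rule_format, OF x(2) m]
    by (rule arg_cong[where f = "\<lambda>l. Some (\<delta> l)"])
qed

text \<open>The cells \<open>h\<^sup>-\<^sup>1 \<triangleright> m\<close> and \<open>m\<close> have coordinates that differ, up to translation by \<open>h\<close>, by an
  element of \<open>H0\<close>, and this is what the invariance of \<open>\<delta>\<close> absorbs.\<close>

lemma local_with_equivariant:
  assumes loc: "local_with k X Y \<Delta>" and X: "subshift X" and Y: "Y \<subseteq> patterns M"
    and x: "x \<in> X" and h: "h \<in> H"
  shows "\<Delta> (pat_act h x) = pat_act h (\<Delta> x)"
proof
  fix m
  interpret group G by (rule group_G)
  obtain N \<delta> where N: "N \<subseteq> cell_ball m0 k" "\<forall>g\<in>G0. \<phi> g ` N \<subseteq> N"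
    "\<forall>h\<in>H0. \<forall>l\<in>restrictions X N. \<delta> (pat_act h l) = \<delta> l"
    "\<forall>x\<in>X. \<forall>m\<in>M.
        \<Delta> x m = Some (\<delta> (\<lambda>n. if n \<in> N then x (m \<lhd>\<^sub>r coset_of n) else None))"
    using loc unfolding local_with_def by (elim conjE exE) (rule that)
  have NM: "N \<subseteq> M" using N(1) cell_ball_subset by blast
  have hx: "pat_act h x \<in> X" by (rule subshift_pat_act[OF X x h])
  have \<Delta>: "\<Delta> w \<in> patterns M" if "w \<in> X" for w
    using loc that Y unfolding local_with_def by blast
  show "\<Delta> (pat_act h x) m = pat_act h (\<Delta> x) m"
  proof (cases "m \<in> M")
    case False
    then show ?thesis using \<Delta>[OF hx] by (simp add: pat_act_def patterns_outside)
  next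
    case m: True
    have hG: "h \<in> carrier G" by (rule H_carrier[OF h])
    define m' where "m' = \<phi> (inv h) m"
    have m': "m' \<in> M" unfolding m'_def using m hG by simp
    have c: "crd m \<in> carrier G" "crd m' \<in> carrier G" using m m' crd_closed by auto
    define g where "g = inv (crd m') \<otimes> (inv h \<otimes> crd m)"
    have "g \<in> G0" unfolding g_def m'_def by (rule stabilizer_of_crd) (use hG m in auto)
    moreover have "g \<in> H" unfolding g_def
      using h m m' crd_H H_subgroup by (simp add: subgroup.m_closed subgroup.m_inv_closed)
    ultimately have g: "g \<in> H0" "g \<in> G0" "inv g \<in> G0"
      using G0_subgroup unfolding H0_def by (auto simp: subgroup.m_inv_closed)
    have gG: "g \<in> carrier G" unfolding g_def using c hG by simp
    have "inv (crd m) \<in> H" using crd_H[OF m] H_subgroup by (simp add: subgroup.m_inv_closed)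
    then have lX: "pat_act (inv (crd m)) (pat_act h x) \<in> X" by (rule subshift_pat_act[OF X hx])
    \<comment> \<open>Written as the restriction of an element of \<open>X\<close>, since
      \<open>\<delta>\<close> is invariant only on \<open>restrictions X N\<close>. The window of
      \<open>x\<close> at \<open>m'\<close> then turns out to be \<open>l\<close> permuted by
      \<open>g\<close>.\<close>
    define l where "l = pat_act (inv (crd m)) (pat_act h x) |` N"
    have l: "l \<in> restrictions X N" unfolding l_def restrictions_def using lX by blast
    have ln: "l n = x (\<phi> (inv h \<otimes> crd m) n)" if "n \<in> N" for n
      using that NM m c hG unfolding l_def pat_act_def by (auto simp: composition_rule)
    have 1: "(\<lambda>n. if n \<in> N then pat_act h x (m \<lhd>\<^sub>r coset_of n) else None) = l"
    proof
      fix n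
      show "(if n \<in> N then pat_act h x (m \<lhd>\<^sub>r coset_of n) else None) = l n"
      proof (cases "n \<in> N")
        case True
        then have n: "n \<in> M" using NM by blast
        then show ?thesis
          using True ln[OF True] m c hG semi_act_coset_of[OF m n]
          by (simp add: pat_act_def composition_rule)
      qed (simp add: l_def)
    qed
    have 2: "(\<lambda>n. if n \<in> N then x (m' \<lhd>\<^sub>r coset_of n) else None) = pat_act g l"
    proof
      fix n
      show "(if n \<in> N then x (m' \<lhd>\<^sub>r coset_of n) else None) = pat_act g l n"
      proof (cases "n \<in> N")
        case True
        then have n: "n \<in> M" using NM by blast
        define n' where "n' = \<phi> (inv g) n"
        have n': "n' \<in> N" "n' \<in> M" using N(2) g(3) True NM unfolding n'_def by blast+
        have "\<phi> (crd m') n = \<phi> (crd m') (\<phi> g n')" unfolding n'_def using gG n by simp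
        also have "\<dots> = \<phi> (crd m' \<otimes> g) n'" using c gG n' by (simp add: composition_rule)
        also have "crd m' \<otimes> g = inv h \<otimes> crd m"
          unfolding g_def using c hG by (simp add: m_assoc[symmetric])
        finally have "x (m' \<lhd>\<^sub>r coset_of n) = l n'"
          using ln[OF n'(1)] semi_act_coset_of[OF m' n] by simp
        then show ?thesis using True n by (simp add: pat_act_def n'_def)
      next
        case False
        have "\<phi> (inv g) n \<notin> N" if "n \<in> M"
        proof
          assume "\<phi> (inv g) n \<in> N"
          then have "\<phi> g (\<phi> (inv g) n) \<in> N" using N(2) g(2) by blast
          then show False using False that gG by simp
        qed
        then show ?thesis using False by (simp add: pat_act_def l_def)
      qed
    qed
    have "\<Delta> (pat_act h x) m = Some (\<delta> l)" unfolding N(4)[rule_format, OF hx m] 1 ..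
    also have "\<dots> = \<Delta> x m'" unfolding N(4)[rule_format, OF x m'] 2 using N(3) g(1) l by simp
    finally show ?thesis using m unfolding pat_act_def m'_def by simp
  qed
qed

text \<open>If \<open>z\<close> were matched by images on every finite set, compactness would
  produce a preimage of \<open>z\<close>.\<close>

lemma local_image_closed:
  assumes loc: "local_with k X Y \<Delta>" and X: "subshift X" and Y: "Y \<subseteq> patterns M"
    and z: "z \<in> patterns M" "z \<notin> \<Delta> ` X"
  shows "\<exists>A. finite A \<and> A \<subseteq> M \<and> (\<forall>x\<in>X. \<exists>m\<in>A. \<Delta> x m \<noteq> z m)"
proof (rule ccontr)
  assume no: "\<not> ?thesis"
  have approx: "\<exists>x\<in>X. \<forall>m\<in>A. \<Delta> x m = z m" if A: "finite A" "A \<subseteq> M" for A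
  proof (rule ccontr)
    assume "\<not> (\<exists>x\<in>X. \<forall>m\<in>A. \<Delta> x m = z m)"
    then have "\<exists>A. finite A \<and> A \<subseteq> M \<and> (\<forall>x\<in>X. \<exists>m\<in>A. \<Delta> x m \<noteq> z m)"
      using A by (intro exI[of _ A]) simp
    then show False using no by contradiction
  qed
  \<comment> \<open>The witness \<open>x\<close> may vary with \<open>A\<close>. Taking
    \<open>A\<close> to be the ball of radius \<open>k\<close> around \<open>m\<close> later
    transfers \<open>\<Delta> x m = z m\<close> to the limit by locality.\<close>
  define P where "P A f \<longleftrightarrow> (\<exists>x\<in>X. \<forall>m\<in>A. x m = f m \<and> \<Delta> x m = z m)" for A f
  have "\<exists>f. (\<forall>m\<in>M. f m \<in> Some ` Q) \<and> (\<forall>A. finite A \<longrightarrow> A \<subseteq> M \<longrightarrow> P A f)"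
  proof (rule finitary_choice_compactness[where K = "\<lambda>_. Some ` Q" and P = P])
    show "P A f" if "A \<subseteq> B" "P B f" for A B f using that unfolding P_def by blast
    show "P A g" if "\<And>i. i \<in> A \<Longrightarrow> f i = g i" "P A f" for A f g
      using that unfolding P_def by fastforce
    show "\<exists>f. (\<forall>i\<in>A. f i \<in> Some ` Q) \<and> P A f" if A: "finite A" "A \<subseteq> M" for A
    proof -
      obtain x where x: "x \<in> X" "\<forall>m\<in>A. \<Delta> x m = z m" using approx[OF A] by blast
      then have "x \<in> patterns M" using subshift_patterns[OF X] by blast
      then have "\<forall>i\<in>A. x i \<in> Some ` Q" using A(2) patterns_value by blast
      moreover have "P A x" unfolding P_def using x by blast
      ultimately show ?thesis by blast
    qed
  qed (use finite_Q in auto)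
  then obtain f where f: "\<forall>m\<in>M. f m \<in> Some ` Q" "\<forall>A. finite A \<longrightarrow> A \<subseteq> M \<longrightarrow> P A f"
    by (elim exE conjE)
  define y where "y = f |` M"
  have ym: "y m = f m" if "m \<in> M" for m using that unfolding y_def by simp
  have "y \<in> patterns M" unfolding y_def using f(1) by (intro patternsI) simp_all
  then have y: "y \<in> X"
  proof (rule subshift_closed[OF X])
    fix A assume "finite A" "A \<subseteq> M"
    then show "\<exists>x\<in>X. \<forall>m\<in>A. x m = y m"
      using f(2)[rule_format, of A] ym unfolding P_def by (metis subsetD)
  qed
  have "\<Delta> y m = z m" for m
  proof (cases "m \<in> M")
    case True
    obtain x where x: "x \<in> X" "\<forall>n\<in>cell_ball m k. x n = f n \<and> \<Delta> x n = z n"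
      using f(2)[rule_format, OF finite_cell_ball[OF True] cell_ball_subset] unfolding P_def by blast
    have "\<Delta> x m = \<Delta> y m"
    proof (rule local_with_cong[OF loc x(1) y True])
      fix n assume "n \<in> cell_ball m k"
      then show "x n = y n" using x(2) ym cell_ball_subset by (metis subsetD)
    qed
    then show ?thesis using x(2) cell_ball_center[OF True] by simp
  next
    case False
    have "\<Delta> y \<in> patterns M" using loc y Y unfolding local_with_def by blast
    then show ?thesis using z(1) False by (simp add: patterns_outside)
  qed
  then have "z = \<Delta> y" by auto
  then show False using z(2) y by blast
qed

section \<open>Counting patterns\<close>

lemma restrictions_eq: "restrictions X A = (\<lambda>x. x |` A) ` X"
  unfolding restrictions_def by auto

lemma restrict_eq_iff: "x |` A = y |` A \<longleftrightarrow> (\<forall>m\<in>A. x m = y m)"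
  unfolding fun_eq_iff restrict_map_def by auto

lemma finite_patterns_on: "finite A \<Longrightarrow> finite (patterns A)"
  unfolding patterns_def using finite_set_of_finite_maps[OF _ finite_Q] by blast

lemma card_patterns_on:
  assumes "finite A"
  shows "card (patterns A) \<le> card Q ^ card A"
proof -
  have "patterns A \<subseteq> (\<lambda>f m. if m \<in> A then Some (f m) else None) ` PiE A (\<lambda>_. Q)"
  proof
    fix p assume p: "p \<in> patterns A"
    define f where "f = restrict (\<lambda>m. the (p m)) A"
    have pA: "p m \<in> Some ` Q" if "m \<in> A" for m
      using p that by (rule patterns_value)
    have "p m = (if m \<in> A then Some (f m) else None)" for m
      using pA[of m] patterns_outside[OF p, of m] unfolding f_def by auto
    moreover have "f \<in> PiE A (\<lambda>_. Q)" unfolding f_def using pA by fastforce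
    ultimately show "p \<in> (\<lambda>f m. if m \<in> A then Some (f m) else None) ` PiE A (\<lambda>_. Q)"
      by (intro image_eqI[of _ _ f]) auto
  qed
  moreover have "finite (PiE A (\<lambda>_. Q))" using assms finite_Q by (intro finite_PiE) auto
  ultimately have "card (patterns A) \<le> card (PiE A (\<lambda>_. Q))"
    using surj_card_le by blast
  then show ?thesis using assms by (simp add: card_PiE)
qed

lemma restrict_patterns: "x \<in> patterns M \<Longrightarrow> A \<subseteq> M \<Longrightarrow> x |` A \<in> patterns A"
  by (rule patternsI) (auto simp: patterns_value)

lemma finite_restrictions:
  assumes "finite A" "A \<subseteq> M" "Z \<subseteq> patterns M"
  shows "finite (restrictions Z A)"
  using finite_patterns_on[OF assms(1)] restrict_patterns assms(2,3)
  unfolding restrictions_eq by (meson finite_subset image_subsetI subsetD)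

text \<open>A pattern on \<open>B\<close> is determined by its parts on \<open>A\<close> and
  \<open>B - A\<close>, so each additional cell costs at most a factor
  \<open>card Q\<close>.\<close>

lemma card_restrictions_le:
  assumes AB: "A \<subseteq> B" and B: "finite B" "B \<subseteq> M" and Z: "Z \<subseteq> patterns M"
  shows "card (restrictions Z B) \<le> card (restrictions Z A) * card Q ^ card (B - A)"
proof -
  have fin: "finite (restrictions Z A)" "finite (patterns (B - A))"
    using finite_restrictions[OF _ _ Z, of A] finite_patterns_on[of "B - A"] AB B
    by (auto intro: finite_subset)
  have "(\<lambda>x. (x |` A, x |` (B - A))) ` Z \<subseteq> restrictions Z A \<times> patterns (B - A)"
    using restrict_patterns[of _ "B - A"] Z B(2) unfolding restrictions_eq by auto
  then have le: "card ((\<lambda>x. (x |` A, x |` (B - A))) ` Z) \<le> card (restrictions Z A \<times> patterns (B - A))"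
    and "finite ((\<lambda>x. (x |` A, x |` (B - A))) ` Z)"
    using fin by (blast intro: card_mono finite_subset)+
  then have "card (restrictions Z B) \<le> card ((\<lambda>x. (x |` A, x |` (B - A))) ` Z)"
    unfolding restrictions_eq by (intro card_image_le_of_determined) (auto simp: restrict_eq_iff)
  also note le
  also have "card (restrictions Z A \<times> patterns (B - A)) \<le> card (restrictions Z A) * card Q ^ card (B - A)"
    using card_patterns_on[of "B - A"] B(1) by (simp add: card_cartesian_product)
  finally show ?thesis .
qed

text \<open>The prohibited configuration is indexed by the centre, because in use \<open>z t\<close>
  is the translate of one configuration by \<open>crd t\<close>. Away from the balls around
  \<open>T\<close> nothing is prohibited, so this set is in general no subshift.\<close>

definition deviating :: "('m \<rightharpoonup> 'q) set \<Rightarrow> ('m \<Rightarrow> 'm \<rightharpoonup> 'q) \<Rightarrow> nat \<Rightarrow> 'm set \<Rightarrow> ('m \<rightharpoonup> 'q) set" where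
  "deviating X z R T = {x \<in> X. \<forall>t\<in>T. \<exists>m\<in>cell_ball t R. x m \<noteq> z t m}"

lemma cell_balls_disjoint:
  assumes "separated (\<rho> + \<sigma>) T" "s \<in> T" "t \<in> T" "s \<noteq> t" "T \<subseteq> M"
  shows "cell_ball s \<rho> \<inter> cell_ball t \<sigma> = {}"
proof (rule ccontr)
  assume "\<not> ?thesis"
  then obtain m where m: "m \<in> M" "path_dist s m \<le> \<rho>" "path_dist t m \<le> \<sigma>"
    unfolding cell_ball_def by auto
  moreover have "s \<in> M" "t \<in> M" using assms by auto
  ultimately have "path_dist s t \<le> \<rho> + \<sigma>"
    using path_dist_triangle[of s m t] path_dist_sym[of t m] by simp
  then show False using assms unfolding separated_def by fastforce
qed

text \<open>By strong irreducibility, each configuration that deviates at the previous centres can be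
  altered near the new centre \<open>t\<close> so as to agree with \<open>z t\<close> there, and the alteration forgets at
  most \<open>card Q ^ card (cell_ball m0 (R + \<kappa>))\<close> patterns.  Hence a fixed proportion is lost at each
  centre.\<close>

lemma card_deviating:
  fixes a :: real
  assumes SI: "strongly_irreducible_with \<kappa> X" and X: "subshift X" and Q: "Q \<noteq> {}"
    and a: "0 \<le> a" "real (card Q ^ card (cell_ball m0 (R + \<kappa>))) * (1 - a) \<le> 1"
    and \<Omega>: "finite \<Omega>" "\<Omega> \<subseteq> M"
    and T: "finite T" "T \<subseteq> M" "separated (R + (R + \<kappa>)) T"
      "\<And>t. t \<in> T \<Longrightarrow> z t \<in> X" "\<And>t. t \<in> T \<Longrightarrow> cell_ball t R \<subseteq> \<Omega>"
  shows "real (card (restrictions (deviating X z R T) \<Omega>)) \<le> a ^ card T * real (card (restrictions X \<Omega>))"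
  using T
proof (induction T)
  case empty
  show ?case unfolding deviating_def by simp
next
  case (insert t T)
  define K where "K = card Q ^ card (cell_ball m0 (R + \<kappa>))"
  define U where "U = restrictions (deviating X z R T) \<Omega>"
  define U' where "U' = restrictions (deviating X z R (insert t T)) \<Omega>"
  define E where "E = cell_ball t R"
  define E' where "E' = cell_ball t (R + \<kappa>)"
  have t: "t \<in> M" "z t \<in> X" "E \<subseteq> \<Omega>" using insert.prems unfolding E_def by auto
  have finE: "finite E" "finite E'" unfolding E_def E'_def using finite_cell_ball t by auto
  have EM: "E \<subseteq> M" unfolding E_def by (rule cell_ball_subset)
  have Zp: "deviating X z R T \<subseteq> patterns M"
    using subshift_patterns[OF X] unfolding deviating_def by auto
  have finU: "finite U" unfolding U_def by (rule finite_restrictions[OF \<Omega> Zp])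
  have U'U: "U' \<subseteq> U" unfolding U_def U'_def restrictions_eq deviating_def by auto
  have IH: "real (card U) \<le> a ^ card T * real (card (restrictions X \<Omega>))"
    unfolding U_def using insert.prems by (intro insert.IH) (auto simp: separated_def)
  \<comment> \<open>Every pattern outside \<open>E'\<close> extends to one that shows
    \<open>z t\<close> on \<open>E\<close>. Such an extension is in \<open>U\<close> but not in
    \<open>U'\<close>, so the lost patterns are at least as many as the patterns on
    \<open>\<Omega> - E'\<close>.\<close>
  have "restrictions (deviating X z R T) (\<Omega> - E') \<subseteq> (\<lambda>u. u |` (\<Omega> - E')) ` (U - U')"
  proof
    fix v assume "v \<in> restrictions (deviating X z R T) (\<Omega> - E')"
    then obtain x where x: "x \<in> deviating X z R T" "v = x |` (\<Omega> - E')"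
      unfolding restrictions_eq by blast
    have "\<exists>y\<in>X. (\<forall>m\<in>\<Omega> - E'. y m = x m) \<and> (\<forall>m\<in>E. y m = z t m)"
    proof (rule strongly_irreducible_glue[OF SI X _ t(2)])
      show "x \<in> X" using x unfolding deviating_def by blast
      show "\<kappa> < path_dist m n" if m: "m \<in> \<Omega> - E'" and n: "n \<in> E" for m n
      proof -
        have mn: "m \<in> M" "n \<in> M" "path_dist t n \<le> R" "R + \<kappa> < path_dist t m"
          using m n \<Omega>(2) EM unfolding E_def E'_def cell_ball_def by auto
        then show ?thesis
          using path_dist_triangle[OF t(1) mn(2,1)] path_dist_sym[OF mn(1,2)] by linarith
      qed
    qed (use \<Omega> finE EM in auto)
    then obtain y where y: "y \<in> X" "\<forall>m\<in>\<Omega> - E'. y m = x m" "\<forall>m\<in>E. y m = z t m" by blast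
    have "y \<in> deviating X z R T"
    proof -
      have "\<exists>m\<in>cell_ball s R. y m \<noteq> z s m" if s: "s \<in> T" for s
      proof -
        obtain m where m: "m \<in> cell_ball s R" "x m \<noteq> z s m"
          using x(1) s unfolding deviating_def by blast
        \<comment> \<open>The separation \<open>R + (R + \<kappa>)\<close> keeps the altered region
          away from the balls at earlier centres, so \<open>y\<close> still deviates there.\<close>
        have "cell_ball s R \<inter> E' = {}"
          unfolding E'_def
          by (rule cell_balls_disjoint[OF insert.prems(2)]) (use s insert in auto)
        moreover have "cell_ball s R \<subseteq> \<Omega>" using insert.prems(4) s by blast
        ultimately have "y m = x m" using y(2) m(1) by blast
        then show ?thesis using m by metis
      qed
      then show ?thesis using y(1) unfolding deviating_def by blast
    qed
    then have "y |` \<Omega> \<in> U" unfolding U_def restrictions_eq by blast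
    moreover have "y |` \<Omega> \<notin> U'"
    proof
      assume "y |` \<Omega> \<in> U'"
      then obtain w where w: "w \<in> deviating X z R (insert t T)" "w |` \<Omega> = y |` \<Omega>"
        unfolding U'_def restrictions_eq by (metis imageE)
      obtain m where m: "m \<in> E" "w m \<noteq> z t m" using w(1) unfolding deviating_def E_def by blast
      have "w m = y m" using w(2) m(1) t(3) unfolding restrict_eq_iff by blast
      then show False using m y(3) by simp
    qed
    moreover have "v = (y |` \<Omega>) |` (\<Omega> - E')"
      unfolding x(2) using y(2) by (auto simp: fun_eq_iff restrict_map_def)
    ultimately show "v \<in> (\<lambda>u. u |` (\<Omega> - E')) ` (U - U')" by blast
  qed
  then have "card (restrictions (deviating X z R T) (\<Omega> - E')) \<le> card ((\<lambda>u. u |` (\<Omega> - E')) ` (U - U'))"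
    using finU by (intro card_mono) auto
  also have "\<dots> \<le> card (U - U')" using finU by (intro card_image_le) auto
  finally have lost: "card (restrictions (deviating X z R T) (\<Omega> - E')) \<le> card (U - U')" .
  have "card (\<Omega> - (\<Omega> - E')) \<le> card E'" using finE by (intro card_mono) auto
  also have "card E' = card (cell_ball m0 (R + \<kappa>))" unfolding E'_def by (rule card_cell_ball[OF t(1)])
  finally have "card Q ^ card (\<Omega> - (\<Omega> - E')) \<le> K"
    unfolding K_def using Q finite_Q by (intro power_increasing) (auto simp: Suc_le_eq card_gt_0_iff)
  moreover have "card U \<le> card (restrictions (deviating X z R T) (\<Omega> - E')) * card Q ^ card (\<Omega> - (\<Omega> - E'))"
    unfolding U_def by (rule card_restrictions_le[OF _ \<Omega> Zp]) auto
  ultimately have "card U \<le> card (U - U') * K"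
    using lost by (meson mult_le_mono order_trans)
  then have "real (card U) \<le> real (card (U - U')) * real K" by (metis of_nat_le_iff of_nat_mult)
  \<comment> \<open>At least the proportion \<open>1 - a\<close> of \<open>U\<close> is lost; for
    \<open>a > 1\<close> the left side is at most 0.\<close>
  then have "(1 - a) * real (card U) \<le> real (card (U - U'))"
  proof (cases "a \<le> 1")
    case True
    assume "real (card U) \<le> real (card (U - U')) * real K"
    then have "(1 - a) * real (card U) \<le> (1 - a) * (real (card (U - U')) * real K)"
      using True by (intro mult_left_mono) auto
    also have "\<dots> = (real K * (1 - a)) * real (card (U - U'))" by simp
    also have "\<dots> \<le> 1 * real (card (U - U'))"
      using a(2) unfolding K_def by (rule mult_right_mono) simp
    finally show ?thesis by simp
  next
    case False
    then have "(1 - a) * real (card U) \<le> 0" by (simp add: mult_le_0_iff)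
    then show ?thesis by linarith
  qed
  moreover have "card U = card U' + card (U - U')"
    using finU U'U by (metis card_Un_disjoint Diff_disjoint Diff_partition finite_Diff finite_subset)
  ultimately have "real (card U') \<le> a * real (card U)" by (simp add: algebra_simps)
  also have "\<dots> \<le> a * (a ^ card T * real (card (restrictions X \<Omega>)))"
    using IH a(1) by (rule mult_left_mono)
  finally show ?case using insert.hyps unfolding U'_def by simp
qed

text \<open>\<open>card_deviating\<close> meets \<open>Foelner_packing\<close> with
  \<open>c = card Q\<close>. The factor for passing from \<open>nbhd F R\<close> to
  \<open>nbhd F \<rho>\<close> is paid in advance; \<open>Myhill\<close> and \<open>Moore\<close>
  each derive the opposite inequality for a suitable \<open>\<rho>\<close>.\<close>

lemma deviating_deficit:
  assumes amenable: "right_amenable"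
    and SI: "strongly_irreducible_with \<kappa> X" and X: "subshift X" and x: "x \<in> X"
  shows "\<exists>F T. finite F \<and> F \<subseteq> M \<and> finite T \<and> T \<subseteq> F \<and> separated (R + R) T \<and>
    card (restrictions (deviating X (\<lambda>t. pat_act (crd t) x) R T) (nbhd F R)) *
      card Q ^ card (nbhd F \<rho> - nbhd F R) < card (restrictions X (nbhd F R))"
proof -
  have "x m0 \<in> Some ` Q"
    using x subshift_patterns[OF X] origin patterns_value by blast
  then have Q: "Q \<noteq> {}" by blast
  then have cQ: "1 \<le> card Q" using finite_Q by (simp add: Suc_le_eq card_gt_0_iff)
  define K where "K = card Q ^ card (cell_ball m0 (R + \<kappa>))"
  \<comment> \<open>The choice makes \<open>K * (1 - a) = K / (K + 1)\<close> at most 1; with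
    \<open>K\<close> instead of \<open>K + 1\<close>, \<open>a\<close> would vanish for
    \<open>K = 1\<close>.\<close>
  define a where "a = 1 - 1 / (real K + 1)"
  have "1 \<le> K" unfolding K_def using cQ by simp
  then have a: "0 < a" "a < 1" "real K * (1 - a) \<le> 1" unfolding a_def by (auto simp: field_simps)
  obtain F T where F: "finite F" "F \<subseteq> M" and T: "T \<subseteq> F" "separated (R + (R + \<kappa>)) T"
    and small: "a ^ card T * real (card Q) ^ card (nbhd F \<rho> - F) < 1"
    using Foelner_packing[OF amenable a(1,2), of "real (card Q)" "R + (R + \<kappa>)" \<rho>] cQ by auto
  define Z where "Z = deviating X (\<lambda>t. pat_act (crd t) x) R T"
  define \<Omega> where "\<Omega> = nbhd F R"
  have finT: "finite T" "T \<subseteq> M" using T(1) F by (auto intro: finite_subset)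
  have \<Omega>: "finite \<Omega>" "\<Omega> \<subseteq> M" "F \<subseteq> \<Omega>"
    unfolding \<Omega>_def using finite_nbhd[OF F] nbhd_subset subset_nbhd[OF F(2)] by auto
  have "real (card (restrictions Z \<Omega>)) \<le> a ^ card T * real (card (restrictions X \<Omega>))"
    unfolding Z_def
  proof (rule card_deviating[OF SI X Q _ _ \<Omega>(1,2) finT T(2)])
    show "pat_act (crd t) x \<in> X" if "t \<in> T" for t
      using that finT(2) crd_H by (intro subshift_pat_act[OF X x]) auto
    show "cell_ball t R \<subseteq> \<Omega>" if "t \<in> T" for t
      using that T(1) unfolding \<Omega>_def nbhd_def by auto
  qed (use a in \<open>auto simp: K_def\<close>)
  then have "real (card (restrictions Z \<Omega>)) * real (card Q) ^ card (nbhd F \<rho> - \<Omega>) \<le>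
      a ^ card T * real (card (restrictions X \<Omega>)) * real (card Q) ^ card (nbhd F \<rho> - F)"
  proof (rule mult_mono)
    have "card (nbhd F \<rho> - \<Omega>) \<le> card (nbhd F \<rho> - F)"
      using \<Omega>(3) finite_nbhd[OF F, of \<rho>] by (intro card_mono) auto
    then show "real (card Q) ^ card (nbhd F \<rho> - \<Omega>) \<le> real (card Q) ^ card (nbhd F \<rho> - F)"
      using cQ by (intro power_increasing) auto
  qed (use a in auto)
  also have "\<dots> = (a ^ card T * real (card Q) ^ card (nbhd F \<rho> - F)) * real (card (restrictions X \<Omega>))"
    by simp
  also have "\<dots> < 1 * real (card (restrictions X \<Omega>))"
  proof (rule mult_strict_right_mono[OF small])
    have "restrictions X \<Omega> \<noteq> {}" unfolding restrictions_eq using x by blast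
    then show "0 < real (card (restrictions X \<Omega>))"
      using finite_restrictions[OF \<Omega>(1,2) subshift_patterns[OF X]] by (simp add: card_gt_0_iff)
  qed
  finally have "real (card (restrictions Z \<Omega>) * card Q ^ card (nbhd F \<rho> - \<Omega>)) <
      real (card (restrictions X \<Omega>))" by simp
  then have "card (restrictions Z \<Omega>) * card Q ^ card (nbhd F \<rho> - \<Omega>) < card (restrictions X \<Omega>)"
    by (rule of_nat_less_iff[THEN iffD1])
  moreover have "separated (R + R) T" using T(2) unfolding separated_def by fastforce
  ultimately show ?thesis using F finT(1) T(1) unfolding Z_def \<Omega>_def by blast
qed

section \<open>The Garden of Eden theorem\<close>

lemma Myhill:
  assumes amenable: "right_amenable" and X: "subshift X" and SFT: "finite_type X"
    and SI: "strongly_irreducible_with \<kappa> X"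
    and loc: "local_with k X X \<Delta>" and inj: "pre_injective X \<Delta>"
  shows "\<Delta> ` X = X"
proof (rule ccontr)
  have Xp: "X \<subseteq> patterns M" by (rule subshift_patterns[OF X])
  have \<Delta>: "\<Delta> x \<in> X" if "x \<in> X" for x using loc that unfolding local_with_def by blast
  then have \<Delta>p: "\<Delta> ` X \<subseteq> patterns M" using Xp by blast
  assume "\<Delta> ` X \<noteq> X"
  then obtain z where z: "z \<in> X" "z \<notin> \<Delta> ` X" using \<Delta> by blast
  have "z \<in> patterns M" using z Xp by blast
  then obtain A where A: "finite A" "A \<subseteq> M" "\<forall>x\<in>X. \<exists>m\<in>A. \<Delta> x m \<noteq> z m"
    using local_image_closed[OF loc X Xp _ z(2)] by blast
  obtain R where R: "A \<subseteq> cell_ball m0 R" using finite_subset_cell_ball[OF A(1,2)] by blast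
  define Z where "Z = deviating X (\<lambda>t. pat_act (crd t) z) R"
  \<comment> \<open>The image is invariant under \<open>H\<close>, so the pattern of
    \<open>z\<close> missed near \<open>m0\<close> is missed around every centre.\<close>
  have image: "\<Delta> ` X \<subseteq> Z T" if T: "T \<subseteq> M" for T
  proof
    fix y assume "y \<in> \<Delta> ` X"
    then obtain x where x: "x \<in> X" "y = \<Delta> x" by blast
    have "\<exists>m\<in>cell_ball t R. y m \<noteq> pat_act (crd t) z m" if "t \<in> T" for t
    proof -
      interpret group G by (rule group_G)
      have t: "t \<in> M" "crd t \<in> carrier G" "crd t \<in> H" using that T crd_closed crd_H by auto
      have it: "inv (crd t) \<in> H" using t H_subgroup by (simp add: subgroup.m_inv_closed)
      define x' where "x' = pat_act (inv (crd t)) x"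
      have x': "x' \<in> X" unfolding x'_def by (rule subshift_pat_act[OF X x(1) it])
      obtain m where m: "m \<in> A" "\<Delta> x' m \<noteq> z m" using A(3) x' by blast
      have mM: "m \<in> M" using m A by blast
      have "pat_act (crd t) x' = x"
        unfolding x'_def using t x(1) Xp by (intro pat_act_inv) auto
      then have "y = pat_act (crd t) (\<Delta> x')"
        using local_with_equivariant[OF loc X Xp x' t(3)] x(2) by simp
      then have "y (\<phi> (crd t) m) \<noteq> pat_act (crd t) z (\<phi> (crd t) m)"
        using m mM t by simp
      moreover have "\<phi> (crd t) m \<in> cell_ball t R"
        using act_cell_ball[OF t(2) origin, of R] R m(1) crd_act[OF t(1)] by auto
      ultimately show ?thesis by blast
    qed
    then show "y \<in> Z T" unfolding Z_def deviating_def using x \<Delta> by blast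
  qed
  \<comment> \<open>\<open>R\<close> for the counted region, \<open>\<kappa>\<close> for the gluing
    zone around it, \<open>k\<close> for the windows of \<open>\<Delta>\<close>: beyond this radius
    the images of all elements of \<open>Y\<close> coincide with \<open>\<Delta> z\<close>.\<close>
  define \<rho> where "\<rho> = R + \<kappa> + k"
  obtain F T where F: "finite F" "F \<subseteq> M" and T: "T \<subseteq> F"
    and small: "card (restrictions (Z T) (nbhd F R)) *
      card Q ^ card (nbhd F \<rho> - nbhd F R) < card (restrictions X (nbhd F R))"
    using deviating_deficit[OF amenable SI X z(1), of R \<rho>] unfolding Z_def by blast
  define \<Omega> where "\<Omega> = nbhd F R"
  define V where "V = nbhd F \<rho>"
  have \<Omega>: "finite \<Omega>" "\<Omega> \<subseteq> M" unfolding \<Omega>_def using finite_nbhd[OF F] nbhd_subset by auto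
  have V: "finite V" "V \<subseteq> M" unfolding V_def using finite_nbhd[OF F] nbhd_subset by auto
  have \<Omega>V: "\<Omega> \<subseteq> V" unfolding \<Omega>_def V_def \<rho>_def by (rule nbhd_mono) auto
  \<comment> \<open>By gluing, \<open>Y\<close> shows every pattern of \<open>X\<close> on
    \<open>\<Omega>\<close>. Two of its elements differ at finitely many cells only, so
    pre-injectivity makes \<open>\<Delta>\<close> injective on \<open>Y\<close>, and the images are
    told apart on \<open>V\<close> alone.\<close>
  define Y where "Y = {y \<in> X. \<forall>m. m \<notin> nbhd \<Omega> \<kappa> \<longrightarrow> y m = z m}"
  have "restrictions X \<Omega> \<subseteq> restrictions Y \<Omega>"
  proof
    fix u assume "u \<in> restrictions X \<Omega>"
    then obtain x where x: "x \<in> X" "u = x |` \<Omega>" unfolding restrictions_eq by blast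
    obtain y where "y \<in> X" "\<forall>m\<in>\<Omega>. y m = x m" "\<forall>m. m \<notin> nbhd \<Omega> \<kappa> \<longrightarrow> y m = z m"
      using strongly_irreducible_finite_type_glue[OF SI X SFT x(1) z(1) \<Omega>] by blast
    then have "y \<in> Y" "u = y |` \<Omega>" unfolding Y_def x(2) restrict_eq_iff by auto
    then show "u \<in> restrictions Y \<Omega>" unfolding restrictions_eq by blast
  qed
  moreover have YX: "Y \<subseteq> X" unfolding Y_def by blast
  ultimately have YX\<Omega>: "restrictions Y \<Omega> = restrictions X \<Omega>" unfolding restrictions_eq by blast
  have finY: "finite ((\<lambda>y. \<Delta> y |` V) ` Y)"
    by (rule finite_subset[OF _ finite_restrictions[OF V \<Delta>p]]) (use YX in \<open>auto simp: restrictions_eq\<close>)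
  have outside: "\<Delta> y m = \<Delta> z m" if y: "y \<in> Y" and m: "m \<in> M" "m \<notin> V" for y m
  proof (rule local_with_cong[OF loc _ z(1) m(1)])
    show "y \<in> X" using y YX by blast
    fix n assume n: "n \<in> cell_ball m k"
    have "n \<notin> nbhd \<Omega> \<kappa>"
    proof
      assume "n \<in> nbhd \<Omega> \<kappa>"
      then have "n \<in> nbhd F (R + \<kappa>)" unfolding \<Omega>_def using nbhd_nbhd[OF F(2)] by blast
      moreover have "path_dist n m \<le> k" using n m path_dist_sym unfolding cell_ball_def by auto
      ultimately have "m \<in> nbhd (nbhd F (R + \<kappa>)) k" using m unfolding nbhd_iff[of m] by blast
      then show False using m(2) nbhd_nbhd[OF F(2)] unfolding V_def \<rho>_def by blast
    qed
    then show "y n = z n" using y unfolding Y_def by blast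
  qed
  have same: "x = y" if xy: "x \<in> Y" "y \<in> Y" and eq: "\<Delta> x |` V = \<Delta> y |` V" for x y
  proof -
    have "\<Delta> x m = \<Delta> y m" for m
    proof (cases "m \<in> M")
      case True
      then show ?thesis
        using eq outside[OF xy(1), of m] outside[OF xy(2), of m]
        unfolding restrict_eq_iff by (cases "m \<in> V") auto
    next
      case False
      have "w m = None" if "w \<in> X" for w using that Xp False patterns_outside by blast
      then show ?thesis using \<Delta> xy YX by (metis subsetD)
    qed
    then have "\<Delta> x = \<Delta> y" by blast
    moreover have "finite {m \<in> M. x m \<noteq> y m}"
    proof (rule finite_subset)
      show "{m \<in> M. x m \<noteq> y m} \<subseteq> nbhd \<Omega> \<kappa>"
      proof
        fix m assume "m \<in> {m \<in> M. x m \<noteq> y m}"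
        then show "m \<in> nbhd \<Omega> \<kappa>" using xy unfolding Y_def by (metis (mono_tags, lifting) mem_Collect_eq)
      qed
    qed (rule finite_nbhd[OF \<Omega>])
    ultimately show ?thesis using inj xy YX unfolding pre_injective_def by blast
  qed
  have "card (restrictions X \<Omega>) = card ((\<lambda>y. y |` \<Omega>) ` Y)" using YX\<Omega> unfolding restrictions_eq by simp
  also have "\<dots> \<le> card ((\<lambda>y. \<Delta> y |` V) ` Y)"
  proof (rule card_image_le_of_determined[OF finY])
    fix x y assume "x \<in> Y" "y \<in> Y" "\<Delta> x |` V = \<Delta> y |` V"
    then have "x = y" by (rule same)
    then show "x |` \<Omega> = y |` \<Omega>" by simp
  qed
  also have "\<dots> \<le> card (restrictions (\<Delta> ` X) V)"
    using YX by (intro card_mono finite_restrictions[OF V \<Delta>p]) (auto simp: restrictions_eq)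
  also have "\<dots> \<le> card (restrictions (\<Delta> ` X) \<Omega>) * card Q ^ card (V - \<Omega>)"
    by (rule card_restrictions_le[OF \<Omega>V V \<Delta>p])
  also have "\<dots> \<le> card (restrictions (Z T) \<Omega>) * card Q ^ card (V - \<Omega>)"
  proof (rule mult_le_mono1)
    have "Z T \<subseteq> patterns M" using Xp unfolding Z_def deviating_def by blast
    moreover have "\<Delta> ` X \<subseteq> Z T" using T F(2) by (intro image) auto
    ultimately show "card (restrictions (\<Delta> ` X) \<Omega>) \<le> card (restrictions (Z T) \<Omega>)"
      by (intro card_mono finite_restrictions[OF \<Omega>]) (auto simp: restrictions_eq)
  qed
  also have "\<dots> < card (restrictions X \<Omega>)" using small unfolding \<Omega>_def V_def .
  finally show False by simp
qed

text \<open>The windows of \<open>\<Delta>\<close> that meet the swapped region lie inside the ball around \<open>t\<close>, where only the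
  translates of \<open>x\<close> and \<open>x'\<close> are seen, and these have equal images.\<close>

lemma swap_erasable:
  assumes X: "subshift X" and loc: "local_with k X X \<Delta>"
    and splice: "\<And>D x y. D \<subseteq> M \<Longrightarrow> x \<in> X \<Longrightarrow> y \<in> X \<Longrightarrow> \<forall>m\<in>nbhd D r - D. x m = y m \<Longrightarrow>
      override_on y x D \<in> X"
    and x: "x \<in> X" "x' \<in> X" "\<Delta> x = \<Delta> x'" "x \<noteq> x'"
    and differ: "{m \<in> M. x m \<noteq> x' m} \<subseteq> cell_ball m0 \<rho>"
    and R: "R = \<rho> + r + 2 * k"
    and y: "y \<in> X" and t: "t \<in> M" and eq: "\<forall>m\<in>cell_ball t R. y m = pat_act (crd t) x m"
  shows "\<exists>y'\<in>X. \<Delta> y' = \<Delta> y \<and> (\<exists>m\<in>cell_ball t R. y' m \<noteq> pat_act (crd t) x m) \<and>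
    (\<forall>m. m \<notin> cell_ball t R \<longrightarrow> y' m = y m)"
proof -
  have Xp: "X \<subseteq> patterns M" by (rule subshift_patterns[OF X])
  have None: "w m = None" if "w \<in> X" "m \<notin> M" for w m
    using that Xp patterns_outside by blast
  have c: "crd t \<in> carrier G" "crd t \<in> H" using t crd_closed crd_H by auto
  define w where "w = pat_act (crd t) x"
  define w' where "w' = pat_act (crd t) x'"
  have w: "w \<in> X" "w' \<in> X" unfolding w_def w'_def using x c(2) subshift_pat_act[OF X] by auto
  have \<Delta>w: "\<Delta> w = \<Delta> w'"
    unfolding w_def w'_def using local_with_equivariant[OF loc X Xp _ c(2)] x by simp
  define D where "D = {m \<in> M. w m \<noteq> w' m}"
  have D: "D \<subseteq> cell_ball t \<rho>"
  proof
    fix m assume m: "m \<in> D"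
    then have "m \<in> M" unfolding D_def by blast
    then obtain n where n: "n \<in> M" "m = \<phi> (crd t) n" using surj_prop[OF c(1)] by blast
    then have "x n \<noteq> x' n" using m c(1) unfolding D_def w_def w'_def by simp
    then have "n \<in> cell_ball m0 \<rho>" using n(1) differ by blast
    then have "m \<in> \<phi> (crd t) ` cell_ball m0 \<rho>" using n(2) by blast
    then show "m \<in> cell_ball t \<rho>" using act_cell_ball[OF c(1) origin] crd_act[OF t] by simp
  qed
  have DM: "D \<subseteq> M" unfolding D_def by blast
  \<comment> \<open>Within \<open>R\<close>, the term \<open>r\<close> leaves room for the splicing
    ring around \<open>D\<close>, and \<open>2 * k\<close> for a window of radius \<open>k\<close>
    that meets \<open>D\<close>, whose cells are within \<open>2 * k\<close> of the meeting
    point.\<close>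
  have near: "n \<in> cell_ball t R" if "d \<in> D" "path_dist d n \<le> r + 2 * k" "n \<in> M" for d n
  proof -
    have "d \<in> M" "path_dist t d \<le> \<rho>" using that(1) D unfolding cell_ball_def by auto
    then have "path_dist t n \<le> R" using path_dist_triangle[of t d n] t that R by simp
    then show ?thesis using that(3) unfolding cell_ball_def by simp
  qed
  have DR: "D \<subseteq> cell_ball t R"
    using near DM path_dist_self by (metis le0 subsetD subsetI)
  have yw: "y m = w m" if "m \<in> cell_ball t R" for m using eq that unfolding w_def by blast
  have ww': "w m = w' m" if "m \<notin> D" for m
    using that None[OF w(1)] None[OF w(2)] unfolding D_def by (cases "m \<in> M") auto
  define y' where "y' = override_on y w' D"
  have y': "y' \<in> X"
    unfolding y'_def
  proof (rule splice[OF DM w(2) y])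
    show "\<forall>m\<in>nbhd D r - D. w' m = y m"
    proof
      fix m assume m: "m \<in> nbhd D r - D"
      then obtain d where "d \<in> D" "path_dist d m \<le> r" "m \<in> M" by (auto simp: nbhd_iff)
      then have "m \<in> cell_ball t R" using near[of d m] by simp
      then show "w' m = y m" using yw ww' m by simp
    qed
  qed
  \<comment> \<open>Although only \<open>D\<close> is overwritten, \<open>y'\<close> shows
    \<open>w'\<close> on the whole ball, since \<open>w\<close> and \<open>w'\<close> agree off
    \<open>D\<close>.\<close>
  have y'w': "y' m = w' m" if "m \<in> cell_ball t R" for m
    unfolding y'_def using yw[OF that] ww'[of m] by (auto simp: override_on_def)
  have "\<Delta> y' m = \<Delta> y m" for m
  proof (cases "m \<in> M")
    case False
    have "\<Delta> y' \<in> X" "\<Delta> y \<in> X" using loc y y' unfolding local_with_def by auto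
    then show ?thesis using None[OF _ False] by metis
  next
    case m: True
    show ?thesis
    proof (cases "cell_ball m k \<inter> D = {}")
      case True
      then have "y' n = y n" if "n \<in> cell_ball m k" for n
        using that unfolding y'_def by (auto simp: override_on_def)
      then show ?thesis by (intro local_with_cong[OF loc y' y m])
    next
      case False
      then obtain d where d: "d \<in> M" "d \<in> D" "path_dist m d \<le> k" unfolding cell_ball_def by auto
      have ball: "n \<in> cell_ball t R" if "n \<in> cell_ball m k" for n
      proof (rule near[OF d(2)])
        show n: "n \<in> M" using that cell_ball_subset by blast
        have "path_dist m n \<le> k" using that unfolding cell_ball_def by simp
        then show "path_dist d n \<le> r + 2 * k"
          using path_dist_triangle[OF d(1) m n] path_dist_sym[OF d(1) m] d(3) by simp
      qed
      have "\<Delta> y' m = \<Delta> w' m"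
        using y'w' ball by (intro local_with_cong[OF loc y' w(2) m]) auto
      also have "\<dots> = \<Delta> w m" using \<Delta>w by simp
      also have "\<dots> = \<Delta> y m"
        using yw ball by (intro local_with_cong[OF loc w(1) y m]) auto
      finally show ?thesis .
    qed
  qed
  then have "\<Delta> y' = \<Delta> y" by blast
  moreover have "\<exists>m\<in>cell_ball t R. y' m \<noteq> w m"
  proof -
    obtain n where n: "x n \<noteq> x' n" using x(4) by blast
    then have nM: "n \<in> M" using None x(1,2) by metis
    define d where "d = \<phi> (crd t) n"
    have "d \<in> D" unfolding D_def d_def w_def w'_def using n nM c(1) by simp
    then have "d \<in> cell_ball t R" "y' d \<noteq> w d" using DR y'w' unfolding D_def by auto
    then show ?thesis by blast
  qed
  moreover have "\<forall>m. m \<notin> cell_ball t R \<longrightarrow> y' m = y m"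
    unfolding y'_def using DR by (auto simp: override_on_def)
  ultimately show ?thesis using y' unfolding w_def by blast
qed

lemma Moore:
  assumes amenable: "right_amenable" and X: "subshift X" and SFT: "finite_type X"
    and SI: "strongly_irreducible_with \<kappa> X"
    and loc: "local_with k X X \<Delta>" and surj: "\<Delta> ` X = X"
  shows "pre_injective X \<Delta>"
proof (rule ccontr)
  have Xp: "X \<subseteq> patterns M" by (rule subshift_patterns[OF X])
  assume "\<not> pre_injective X \<Delta>"
  then obtain x x' where x: "x \<in> X" "x' \<in> X" "\<Delta> x = \<Delta> x'" "x \<noteq> x'"
    and fin: "finite {m \<in> M. x m \<noteq> x' m}"
    unfolding pre_injective_def by blast
  obtain \<rho> where \<rho>: "{m \<in> M. x m \<noteq> x' m} \<subseteq> cell_ball m0 \<rho>"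
    using finite_subset_cell_ball[OF fin] by blast
  obtain r where r: "\<And>D x y. D \<subseteq> M \<Longrightarrow> x \<in> X \<Longrightarrow> y \<in> X \<Longrightarrow> \<forall>m\<in>nbhd D r - D. x m = y m \<Longrightarrow>
    override_on y x D \<in> X"
    using finite_type_splice[OF SFT] by blast
  define R where "R = \<rho> + r + 2 * k"
  define Z where "Z = deviating X (\<lambda>t. pat_act (crd t) x) R"
  have lift: "\<exists>y\<in>Z T. \<Delta> y = v"
    if T: "finite T" "T \<subseteq> M" "separated (R + R) T" and v: "v \<in> X" for T v
    using T
  proof (induction T)
    case empty
    have "v \<in> \<Delta> ` X" unfolding surj by (rule v)
    then show ?case unfolding Z_def deviating_def by auto
  next
    case (insert t T)
    have "\<exists>y\<in>Z T. \<Delta> y = v"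
      using insert.prems by (intro insert.IH) (auto simp: separated_def)
    then obtain y where y: "y \<in> Z T" "\<Delta> y = v" by blast
    show ?case
    proof (cases "\<forall>m\<in>cell_ball t R. y m = pat_act (crd t) x m")
      case False
      then have "y \<in> Z (insert t T)" using y unfolding Z_def deviating_def by auto
      then show ?thesis using y by blast
    next
      case True
      have "y \<in> X" "t \<in> M" using y insert.prems unfolding Z_def deviating_def by auto
      then obtain y' where y': "y' \<in> X" "\<Delta> y' = \<Delta> y"
        "\<exists>m\<in>cell_ball t R. y' m \<noteq> pat_act (crd t) x m" "\<forall>m. m \<notin> cell_ball t R \<longrightarrow> y' m = y m"
        using swap_erasable[OF X loc r x \<rho> R_def _ _ True] by blast
      have "\<exists>m\<in>cell_ball s R. y' m \<noteq> pat_act (crd s) x m" if s: "s \<in> T" for s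
      proof -
        obtain m where m: "m \<in> cell_ball s R" "y m \<noteq> pat_act (crd s) x m"
          using y(1) s unfolding Z_def deviating_def by blast
        have "cell_ball s R \<inter> cell_ball t R = {}"
          by (rule cell_balls_disjoint[OF insert.prems(2)]) (use s insert in auto)
        then have "y' m = y m" using y'(4) m(1) by blast
        then show ?thesis using m by metis
      qed
      then have "y' \<in> Z (insert t T)" using y' unfolding Z_def deviating_def by blast
      then show ?thesis using y'(2) y(2) by blast
    qed
  qed
  obtain F T where F: "finite F" "F \<subseteq> M" and T: "finite T" "T \<subseteq> F" "separated (R + R) T"
    and small: "card (restrictions (Z T) (nbhd F R)) *
      card Q ^ card (nbhd F (R + k) - nbhd F R) < card (restrictions X (nbhd F R))"
    using deviating_deficit[OF amenable SI X x(1), of R "R + k"] unfolding Z_def by blast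
  define \<Omega> where "\<Omega> = nbhd F R"
  \<comment> \<open>The margin \<open>k\<close> lets the values on \<open>V\<close> determine the
    image on \<open>\<Omega>\<close>. Hence patterns on \<open>V\<close> of configurations in
    \<open>Z T\<close> are at least as many as patterns of \<open>X\<close> on
    \<open>\<Omega>\<close>, against the deficit.\<close>
  define V where "V = nbhd F (R + k)"
  have V: "finite V" "V \<subseteq> M" unfolding V_def using finite_nbhd[OF F] nbhd_subset by auto
  have \<Omega>V: "\<Omega> \<subseteq> V" unfolding \<Omega>_def V_def by (rule nbhd_mono) auto
  have ZX: "Z T \<subseteq> X" unfolding Z_def deviating_def by blast
  have Zp: "Z T \<subseteq> patterns M" using ZX Xp by blast
  have "X \<subseteq> \<Delta> ` Z T" using lift[OF T(1) _ T(3)] T(2) F(2) by blast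
  moreover have "\<Delta> ` Z T \<subseteq> X" using ZX surj by blast
  ultimately have "card (restrictions X \<Omega>) = card ((\<lambda>y. \<Delta> y |` \<Omega>) ` Z T)"
    unfolding restrictions_eq by (simp add: subset_antisym image_image)
  also have "\<dots> \<le> card ((\<lambda>y. y |` V) ` Z T)"
  proof (rule card_image_le_of_determined)
    show "finite ((\<lambda>y. y |` V) ` Z T)" using finite_restrictions[OF V Zp] unfolding restrictions_eq .
    fix y y' assume y: "y \<in> Z T" "y' \<in> Z T" and eq: "y |` V = y' |` V"
    have "\<Delta> y m = \<Delta> y' m" if m: "m \<in> \<Omega>" for m
    proof (rule local_with_cong[OF loc])
      show "y \<in> X" "y' \<in> X" using y ZX by auto
      show "m \<in> M" using m \<Omega>V V by blast
      fix n assume "n \<in> cell_ball m k"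
      then have "n \<in> nbhd \<Omega> k" using m unfolding nbhd_def by blast
      then have "n \<in> V" unfolding \<Omega>_def V_def using nbhd_nbhd[OF F(2)] by blast
      then show "y n = y' n" using eq unfolding restrict_eq_iff by blast
    qed
    then show "\<Delta> y |` \<Omega> = \<Delta> y' |` \<Omega>" unfolding restrict_eq_iff by blast
  qed
  also have "\<dots> \<le> card (restrictions (Z T) \<Omega>) * card Q ^ card (V - \<Omega>)"
    using card_restrictions_le[OF \<Omega>V V Zp] unfolding restrictions_eq .
  also have "\<dots> < card (restrictions X \<Omega>)" using small unfolding \<Omega>_def V_def .
  finally show False by simp
qed

end

theorem corollary4p8:
  fixes G :: "('g, 'z) monoid_scheme"
    and M :: "'m set"
    and \<phi> :: "'g \<Rightarrow> 'm \<Rightarrow> 'm"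
    and m0 :: 'm
    and crd :: "'m \<Rightarrow> 'g"
    and S :: "'g set set"
    and H :: "'g set"
    and Q :: "'q set"
    and X :: "('m \<rightharpoonup> 'q) set"
  assumes "pattern_space G M \<phi> m0 crd S H Q"
    and "cell_space.right_amenable G M \<phi> m0 crd"
    and "pattern_space.subshift G M \<phi> H Q X"
    and "pattern_space.finite_type G M \<phi> H Q X"
    and "pattern_space.strongly_irreducible G M \<phi> m0 crd S H Q X"
  shows "pattern_space.Moore_property G M \<phi> m0 crd S H Q X \<and>
         pattern_space.Myhill_property G M \<phi> m0 crd S H Q X"
proof -
  interpret pattern_space G M \<phi> m0 crd S H Q by (rule assms(1))
  obtain \<kappa> where SI: "strongly_irreducible_with \<kappa> X"
    using assms(5) unfolding strongly_irreducible_def by blast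
  show ?thesis
    unfolding Moore_property_def Myhill_property_def local_map_def
    using Moore[OF assms(2-4) SI] Myhill[OF assms(2-4) SI] by blast
qed

end
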